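(* Let $A$ be a Hermitian unital Banach $\ast$-algebra. For any $a,b\in A$ with $a>0$ and $b>0$ we have $$b\,\sharp_{1-\nu}\,a=a\,\sharp_{\nu}\,b$$ for any real number $\nu$.
   Context: A unital Banach $\ast$-algebra $A$ (unit $1$) is called Hermitian if every selfadjoint $a\in A$ (i.e. $a^{\ast}=a$) has spectrum $\sigma(a)\subset\mathbb{R}$. The involution is not assumed continuous. Write $a\geq 0$ if $a^{\ast}=a$ and $\sigma(a)\subset[0,\infty)$; write $a>0$ if $a\geq 0$ and $0\notin\sigma(a)$. Real powers: for $a>0$ and $\alpha\in\mathbb{R}$, $a^{\alpha}:=\frac{1}{2\pi i}\int_{\gamma}z^{\alpha}(z-a)^{-1}dz$, where $z^{\alpha}$ is the principal power and $\gamma$ is a closed rectifiable curve in $\{\mathrm{Re}\,z>0\}$ enclosing $\sigma(a)$ (winding once counterclockwise). Weighted geometric mean: for $a,b>0$ and $\nu\in\mathbb{R}$, $a\,\sharp_{\nu}\,b:=a^{1/2}\left(a^{-1/2}ba^{-1/2}\right)^{\nu}a^{1/2}$. *)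

theory Defs
  imports "HOL-Complex_Analysis.Complex_Analysis"
begin

text \<open>
  Complex unital Banach algebras. The library only provides real normed algebras, so complex
  scalars are added on top of the real structure. The unit is only required to be nonzero;
  \<open>norm 1 = 1\<close> is not assumed.
\<close>

class complex_banach_algebra = real_algebra_1 + real_normed_algebra + banach +
  fixes scaleC :: "complex \<Rightarrow> 'a \<Rightarrow> 'a"  (infixr \<open>*\<^sub>C\<close> 75)
  assumes scaleC_of_real: "complex_of_real r *\<^sub>C x = r *\<^sub>R x"
    and scaleC_add_right: "c *\<^sub>C (x + y) = c *\<^sub>C x + c *\<^sub>C y"
    and scaleC_add_left: "(c + d) *\<^sub>C x = c *\<^sub>C x + d *\<^sub>C x"
    and scaleC_scaleC: "c *\<^sub>C (d *\<^sub>C x) = (c * d) *\<^sub>C x"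
    and mult_scaleC_left: "(c *\<^sub>C x) * y = c *\<^sub>C (x * y)"
    and mult_scaleC_right: "x * (c *\<^sub>C y) = c *\<^sub>C (x * y)"
    and norm_scaleC: "norm (c *\<^sub>C x) = cmod c * norm x"

text \<open>The involution is purely algebraic: it is assumed neither isometric nor continuous.\<close>

class banach_star_algebra = complex_banach_algebra +
  fixes star :: "'a \<Rightarrow> 'a"  (\<open>_\<^sup>\<star>\<close> [1000] 999)
  assumes star_star: "(x\<^sup>\<star>)\<^sup>\<star> = x"
    and star_add: "(x + y)\<^sup>\<star> = x\<^sup>\<star> + y\<^sup>\<star>"
    and star_scaleC: "(c *\<^sub>C x)\<^sup>\<star> = cnj c *\<^sub>C x\<^sup>\<star>"
    and star_mult: "(x * y)\<^sup>\<star> = y\<^sup>\<star> * x\<^sup>\<star>"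

definition is_invertible :: "'a::ring_1 \<Rightarrow> bool" where
  "is_invertible x \<longleftrightarrow> (\<exists>y. x * y = 1 \<and> y * x = 1)"

definition ring_inverse :: "'a::ring_1 \<Rightarrow> 'a" where
  "ring_inverse x = (THE y. x * y = 1 \<and> y * x = 1)"

definition spectrum :: "'a::complex_banach_algebra \<Rightarrow> complex set" where
  "spectrum a = {z. \<not> is_invertible (z *\<^sub>C 1 - a)}"

definition selfadjoint :: "'a::banach_star_algebra \<Rightarrow> bool" where
  "selfadjoint a \<longleftrightarrow> a\<^sup>\<star> = a"

definition hermitian_algebra :: "'a::banach_star_algebra itself \<Rightarrow> bool" where
  "hermitian_algebra _ \<longleftrightarrow> (\<forall>a::'a. selfadjoint a \<longrightarrow> spectrum a \<subseteq> \<real>)"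

definition nonneg :: "'a::banach_star_algebra \<Rightarrow> bool" where
  "nonneg a \<longleftrightarrow> selfadjoint a \<and> spectrum a \<subseteq> \<real>\<^sub>\<ge>\<^sub>0"

definition strictly_pos :: "'a::banach_star_algebra \<Rightarrow> bool" where
  "strictly_pos a \<longleftrightarrow> nonneg a \<and> 0 \<notin> spectrum a"

text \<open>
  Algebra-valued analogue of \<^const>\<open>contour_integral\<close>, for piecewise continuously differentiable
  paths.
\<close>

definition alg_contour_integral ::
    "(real \<Rightarrow> complex) \<Rightarrow> (complex \<Rightarrow> 'a::complex_banach_algebra) \<Rightarrow> 'a" where
  "alg_contour_integral \<gamma> f =
     integral {0..1} (\<lambda>t. vector_derivative \<gamma> (at t within {0..1}) *\<^sub>C f (\<gamma> t))"

definition encloses_spectrum :: "(real \<Rightarrow> complex) \<Rightarrow> 'a::complex_banach_algebra \<Rightarrow> bool" where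
  "encloses_spectrum \<gamma> a \<longleftrightarrow>
     valid_path \<gamma> \<and> pathfinish \<gamma> = pathstart \<gamma> \<and>
     path_image \<gamma> \<subseteq> {z. Re z > 0} - spectrum a \<and>
     (\<forall>z\<in>spectrum a. winding_number \<gamma> z = 1)"

text \<open>
  The curve is an arbitrary admissible one; the value does not depend on which, by Cauchy's theorem
  (the integrand is holomorphic on the right half-plane minus the spectrum).
  The value is meaningful only if the spectrum lies in the open right half-plane; otherwise no
  admissible curve exists.
\<close>

definition rpow :: "'a::complex_banach_algebra \<Rightarrow> real \<Rightarrow> 'a" where
  "rpow a \<alpha> =
     (let \<gamma> = (SOME \<gamma>. encloses_spectrum \<gamma> a)
      in (1 / (2 * complex_of_real pi * \<i>)) *\<^sub>C
           alg_contour_integral \<gamma> (\<lambda>z. (z powr complex_of_real \<alpha>) *\<^sub>C ring_inverse (z *\<^sub>C 1 - a)))"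

definition geo_mean :: "'a::complex_banach_algebra \<Rightarrow> real \<Rightarrow> 'a \<Rightarrow> 'a"
    (\<open>(_ \<sharp>\<^bsub>_\<^esub> _)\<close> [71, 0, 71] 70) where
  "a \<sharp>\<^bsub>\<nu>\<^esub> b =
     rpow a (1/2) * rpow (rpow a (-1/2) * b * rpow a (-1/2)) \<nu> * rpow a (1/2)"

end

theory Submission imports Defs begin

text \<open>
  Write \<open>x = a powr (-1/2) * b powr (1/2)\<close> and \<open>y = b powr (1/2) * a powr (-1/2)\<close>. Then
  \<open>c = a powr (-1/2) * b * a powr (-1/2)\<close> is \<open>x * y\<close>, and the corresponding element for the
  interchanged pair, \<open>b powr (-1/2) * a * b powr (-1/2)\<close>, is the inverse of
  \<open>e = y * x = y * c * y\<^sup>-\<^sup>1\<close>. Hence its power with exponent \<open>1 - \<nu>\<close> is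
  \<open>e\<^sup>-\<^sup>1 * e powr \<nu> = e\<^sup>-\<^sup>1 * y * c powr \<nu> * y\<^sup>-\<^sup>1\<close>, and multiplication by \<open>b powr (1/2)\<close> on both
  sides turns this into \<open>a powr (1/2) * c powr \<nu> * a powr (1/2)\<close>. The calculation rests on two
  things: the laws of powers, including \<open>(e\<^sup>-\<^sup>1) powr \<alpha> = e powr (-\<alpha>)\<close>, and the positivity
  of the spectrum of \<open>c\<close>, without which its power means nothing.

  The laws of powers (lemmas \<open>rpow_add\<close>, \<open>rpow_similar\<close>, \<open>rpow_ring_inverse\<close>). The
  Hahn--Banach theorem reduces Cauchy's theory for algebra-valued functions to that for complex
  functions. Let \<open>f\<close> be the power function, and choose \<open>C\<close> so large that the curve lies in
  the disc about \<open>C\<close> with radius \<open>C\<close>. There \<open>f\<close> is a power series, which also converges at \<open>a\<close> by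
  the spectral radius formula; call the value \<open>f a\<close>. Since \<open>f z - f a = (z - a) * h z\<close>
  with \<open>h\<close> analytic on the disc, \<open>f z * (z - a)\<^sup>-\<^sup>1\<close> and \<open>f a * (z - a)\<^sup>-\<^sup>1\<close> have the same integral,
  and the integral of \<open>(z - a)\<^sup>-\<^sup>1\<close> over any closed curve that winds once about every point of the spectrum
  is \<open>2 \<pi> \<i>\<close> (lemma \<open>contour_integral_resolvent\<close>). So powers are binomial series, whatever the
  curve, and the addition of exponents is Vandermonde's identity. The power of an inverse comes
  from the substitution \<open>z \<mapsto> 1 / z\<close> in the integral.

  The positivity of \<open>c\<close> (lemma \<open>positive_spectrum_conjugate\<close>) is where the algebra has to be
  Hermitian. By Ford's lemma (\<open>selfadjoint_rpow_half\<close>) the square root of a positive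
  selfadjoint element is selfadjoint even if the involution is discontinuous, because the root is
  unique. So \<open>c\<close> is selfadjoint and its spectrum is real; for \<open>r \<ge> 0\<close> the element \<open>r + c\<close> is congruent
  to \<open>r a + b\<close>, and it remains to show that a sum of two positive elements is invertible. Cayley
  transforms \<open>h\<close> and \<open>k\<close> of the summands reduce this to \<open>1 - h k\<close>, where \<open>h\<close> and \<open>k\<close> are selfadjoint with
  spectral radius below \<open>1\<close>. Ptak's inequality \<open>r(x)\<^sup>2 \<le> r(x\<^sup>\<star> x)\<close>, iterated, gives \<open>r(h k) < 1\<close>.
\<close>

section \<open>Complex scalars\<close>

lemma scaleC_zero_left [simp]: "0 *\<^sub>C (x::'a::complex_banach_algebra) = 0"
  using scaleC_of_real[of 0 x] by simp

lemma scaleC_zero_right [simp]: "c *\<^sub>C (0::'a::complex_banach_algebra) = 0"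
  using scaleC_add_right[of c 0 0] by simp

lemma scaleC_one [simp]: "1 *\<^sub>C (x::'a::complex_banach_algebra) = x"
  using scaleC_of_real[of 1 x] by simp

lemma scaleC_minus_left: "(- c) *\<^sub>C (x::'a::complex_banach_algebra) = - (c *\<^sub>C x)"
  using scaleC_add_left[of c "- c" x] by (simp add: eq_neg_iff_add_eq_0 add.commute)

lemma scaleC_minus_right: "c *\<^sub>C (- x::'a::complex_banach_algebra) = - (c *\<^sub>C x)"
  using scaleC_add_right[of c x "- x"] by (simp add: eq_neg_iff_add_eq_0 add.commute)

lemma scaleC_diff_left: "(c - d) *\<^sub>C (x::'a::complex_banach_algebra) = c *\<^sub>C x - d *\<^sub>C x"
  using scaleC_add_left[of c "- d" x] by (simp add: scaleC_minus_left)

lemma scaleC_diff_right: "c *\<^sub>C (x - y::'a::complex_banach_algebra) = c *\<^sub>C x - c *\<^sub>C y"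
  using scaleC_add_right[of c x "- y"] by (simp add: scaleC_minus_right)

lemma scaleC_scaleR: "c *\<^sub>C (r *\<^sub>R (x::'a::complex_banach_algebra)) = r *\<^sub>R (c *\<^sub>C x)"
  by (simp add: scaleC_of_real[symmetric] scaleC_scaleC mult.commute)

lemma scaleR_scaleC: "r *\<^sub>R (c *\<^sub>C (x::'a::complex_banach_algebra)) = (of_real r * c) *\<^sub>C x"
  by (simp add: scaleC_of_real[symmetric] scaleC_scaleC)

lemmas scaleC_algebra_simps =
  scaleC_add_left scaleC_add_right scaleC_diff_left scaleC_diff_right scaleC_minus_left
  scaleC_minus_right mult_scaleC_left mult_scaleC_right

lemma bounded_bilinear_scaleC:
  "bounded_bilinear ((*\<^sub>C) :: complex \<Rightarrow> 'a::complex_banach_algebra \<Rightarrow> 'a)"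
proof
  show "\<exists>K. \<forall>c (x::'a). norm (c *\<^sub>C x) \<le> norm c * norm x * K"
    by (intro exI[of _ 1]) (simp add: norm_scaleC)
qed (simp_all add: scaleC_add_left scaleC_add_right scaleC_scaleR scaleR_scaleC
      scaleR_conv_of_real[where 'a = complex])

lemmas continuous_on_scaleC [continuous_intros] =
  bounded_bilinear.continuous_on[OF bounded_bilinear_scaleC]

section \<open>Functionals separating points\<close>

definition sublinear :: "('a::real_vector \<Rightarrow> real) \<Rightarrow> bool" where
  "sublinear p \<longleftrightarrow> (\<forall>x y. p (x + y) \<le> p x + p y) \<and> (\<forall>r>0. \<forall>x. p (r *\<^sub>R x) \<le> r * p x)"

lemma sublinear_add: "sublinear p \<Longrightarrow> p (x + y) \<le> p x + p y"
  by (simp add: sublinear_def)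

lemma sublinear_scale:
  assumes "sublinear p" "r > 0"
  shows "p (r *\<^sub>R x) = r * p x"
proof (rule antisym)
  show "p (r *\<^sub>R x) \<le> r * p x" using assms by (simp add: sublinear_def)
  have "p ((1/r) *\<^sub>R (r *\<^sub>R x)) \<le> (1/r) * p (r *\<^sub>R x)"
    using assms unfolding sublinear_def by (metis zero_less_divide_1_iff)
  then show "r * p x \<le> p (r *\<^sub>R x)" using assms(2) by (simp add: field_simps)
qed

lemma sublinear_zero: "sublinear p \<Longrightarrow> p 0 = 0"
  using sublinear_scale[of p 2 0] by simp

lemma sublinear_neg: "sublinear p \<Longrightarrow> - p (- x) \<le> p x"
  using sublinear_add[of p x "- x"] sublinear_zero[of p] by simp

text \<open>
  Below a sublinear functional \<open>p\<close> there is one that is as small as possible at \<open>- y\<close>: the infimum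
  of \<open>p\<close> along the ray in direction \<open>y\<close>, corrected by the growth of \<open>p\<close> on that ray. A minimal functional admits no improvement and is therefore
  linear, which turns the Hahn--Banach theorem into an application of Zorn's lemma.
\<close>

lemma sublinear_improve:
  assumes p: "sublinear p"
  obtains q where "sublinear q" "\<And>x. q x \<le> p x" "q (- y) \<le> - p y"
proof
  define q where "q x = (INF t\<in>{0..}. p (x + t *\<^sub>R y) - t * p y)" for x
  have lb: "- p (- x) \<le> p (x + t *\<^sub>R y) - t * p y" if "t \<ge> 0" for x t
  proof -
    have "t * p y = p (t *\<^sub>R y)"
      using that p by (cases "t = 0") (simp_all add: sublinear_scale sublinear_zero)
    also have "\<dots> \<le> p (x + t *\<^sub>R y) + p (- x)"
      using sublinear_add[OF p, of "x + t *\<^sub>R y" "- x"] by simp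
    finally show ?thesis by simp
  qed
  have bdd: "bdd_below ((\<lambda>t. p (x + t *\<^sub>R y) - t * p y) ` {0..})" for x
    using lb by (intro bdd_belowI2) auto
  have le: "q x \<le> p (x + t *\<^sub>R y) - t * p y" if "t \<ge> 0" for x t
    unfolding q_def using bdd that by (intro cINF_lower) auto
  have ge: "c \<le> q x" if "\<And>t. t \<ge> 0 \<Longrightarrow> c \<le> p (x + t *\<^sub>R y) - t * p y" for c x
    unfolding q_def using that by (intro cINF_greatest) auto
  have add: "q (x1 + x2) \<le> q x1 + q x2" for x1 x2
  proof -
    have *: "q (x1 + x2) \<le> (p (x1 + s *\<^sub>R y) - s * p y) + (p (x2 + t *\<^sub>R y) - t * p y)"
      if "s \<ge> 0" "t \<ge> 0" for s t
    proof -
      have "q (x1 + x2) \<le> p (x1 + x2 + (s + t) *\<^sub>R y) - (s + t) * p y"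
        using that by (intro le) auto
      also have "p (x1 + x2 + (s + t) *\<^sub>R y) \<le> p (x1 + s *\<^sub>R y) + p (x2 + t *\<^sub>R y)"
        using sublinear_add[OF p, of "x1 + s *\<^sub>R y" "x2 + t *\<^sub>R y"] by (simp add: algebra_simps)
      finally show ?thesis by (simp add: algebra_simps)
    qed
    have "q (x1 + x2) - (p (x1 + s *\<^sub>R y) - s * p y) \<le> q x2" if "s \<ge> 0" for s
      using *[OF that] by (intro ge) (simp add: algebra_simps)
    then have "q (x1 + x2) - q x2 \<le> q x1"
      by (intro ge) (simp add: algebra_simps)
    then show ?thesis by simp
  qed
  have scale: "q (r *\<^sub>R x) \<le> r * q x" if "r > 0" for r x
  proof -
    have "q (r *\<^sub>R x) / r \<le> p (x + t *\<^sub>R y) - t * p y" if "t \<ge> 0" for t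
    proof -
      have "q (r *\<^sub>R x) \<le> p (r *\<^sub>R x + (r * t) *\<^sub>R y) - (r * t) * p y"
        using that \<open>r > 0\<close> by (intro le) auto
      also have "p (r *\<^sub>R x + (r * t) *\<^sub>R y) = r * p (x + t *\<^sub>R y)"
        using sublinear_scale[OF p \<open>r > 0\<close>, of "x + t *\<^sub>R y"] by (simp add: scaleR_add_right)
      finally have "q (r *\<^sub>R x) \<le> r * (p (x + t *\<^sub>R y) - t * p y)"
        by (simp add: algebra_simps)
      then show ?thesis using \<open>r > 0\<close> by (simp add: field_simps)
    qed
    then have "q (r *\<^sub>R x) / r \<le> q x" by (rule ge)
    then show ?thesis using \<open>r > 0\<close> by (simp add: field_simps)
  qed
  show "sublinear q" using add scale by (simp add: sublinear_def)
  show "q x \<le> p x" for x using le[of 0 x] by simp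
  show "q (- y) \<le> - p y" using le[of 1 "- y"] sublinear_zero[OF p] by simp
qed

lemma sublinear_minimal:
  assumes p: "sublinear p"
  obtains q where "sublinear q" "\<And>x. q x \<le> p x"
    "\<And>q'. sublinear q' \<Longrightarrow> (\<And>x. q' x \<le> q x) \<Longrightarrow> q' = q"
proof -
  define A where "A = {q. sublinear q \<and> q \<le> p}"
  have "\<exists>m\<in>A. \<forall>a\<in>A. a \<le> m \<longrightarrow> a = m"
  proof (rule predicate_Zorn)
    show "partial_order_on A (relation_of (\<lambda>q q'. q' \<le> q) A)"
      by (intro partial_order_on_relation_ofI) auto
    fix C assume C: "C \<in> Chains (relation_of (\<lambda>q q'. q' \<le> q) A)"
    then have CA: "q \<in> A" if "q \<in> C" for q
      using that by (auto simp: Chains_def relation_of_def)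
    have tot: "q \<le> q' \<or> q' \<le> q" if "q \<in> C" "q' \<in> C" for q q'
      using C that by (auto simp: Chains_def relation_of_def)
    show "\<exists>u\<in>A. \<forall>a\<in>C. u \<le> a"
    proof (cases "C = {}")
      case True
      then show ?thesis using p by (auto simp: A_def)
    next
      case False
      define u where "u x = (INF q\<in>C. q x)" for x
      have bdd: "bdd_below ((\<lambda>q. q x) ` C)" for x
      proof (rule bdd_belowI2)
        fix q assume "q \<in> C"
        then have "sublinear q" "q (- x) \<le> p (- x)" using CA by (auto simp: A_def le_fun_def)
        then show "- p (- x) \<le> q x" using sublinear_neg[of q x] by simp
      qed
      have le: "u x \<le> q x" if "q \<in> C" for q x
        unfolding u_def using bdd that by (intro cINF_lower) auto
      have ge: "c \<le> u x" if "\<And>q. q \<in> C \<Longrightarrow> c \<le> q x" for c x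
        unfolding u_def using that False by (intro cINF_greatest) auto
      have sub: "u (x + y) \<le> u x + u y" for x y
      proof -
        have *: "u (x + y) \<le> q x + q' y" if qs: "q \<in> C" "q' \<in> C" for q q'
        proof -
          obtain m where m: "m \<in> C" "m \<le> q" "m \<le> q'" using tot[OF qs] qs by blast
          then have "u (x + y) \<le> m x + m y"
            using le[OF m(1), of "x + y"] CA[OF m(1)] sublinear_add[of m x y]
            by (auto simp: A_def)
          then show ?thesis using m(2,3)[THEN le_funD, of x] m(2,3)[THEN le_funD, of y] by linarith
        qed
        have "u (x + y) - q x \<le> u y" if "q \<in> C" for q
          using *[OF that] by (intro ge) (simp add: algebra_simps)
        then have "u (x + y) - u y \<le> u x"
          by (intro ge) (simp add: algebra_simps)
        then show ?thesis by simp
      qed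
      have scl: "u (r *\<^sub>R x) \<le> r * u x" if "r > 0" for r x
      proof -
        have "u (r *\<^sub>R x) / r \<le> q x" if "q \<in> C" for q
          using le[OF that, of "r *\<^sub>R x"] sublinear_scale[of q r x] CA[OF that] \<open>r > 0\<close>
          by (auto simp: A_def field_simps)
        then have "u (r *\<^sub>R x) / r \<le> u x" by (rule ge)
        then show ?thesis using that by (simp add: field_simps)
      qed
      have "sublinear u" using sub scl by (simp add: sublinear_def)
      moreover have "u \<le> p"
      proof -
        obtain q where "q \<in> C" using False by blast
        then show ?thesis using le[of q] CA[of q] by (auto simp: A_def le_fun_def dest: order_trans)
      qed
      ultimately show ?thesis using le by (auto simp: A_def le_fun_def)
    qed
  qed
  then obtain m where m: "m \<in> A" "\<And>a. a \<in> A \<Longrightarrow> a \<le> m \<Longrightarrow> a = m" by blast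
  show ?thesis
  proof
    show "sublinear m" "\<And>x. m x \<le> p x" using m(1) by (auto simp: A_def le_fun_def)
    fix q' assume "sublinear q'" "\<And>x. q' x \<le> m x"
    moreover have "q' \<le> p" using calculation(2) m(1) order_trans[of q' m p]
      by (auto simp: A_def le_fun_def)
    ultimately show "q' = m"
      by (intro m(2)) (auto simp: A_def le_fun_def)
  qed
qed

lemma linear_below_sublinear:
  assumes p: "sublinear p"
  obtains f where "linear f" "\<And>x. f x \<le> p x"
proof -
  obtain q where q: "sublinear q" "\<And>x. q x \<le> p x"
    and min: "\<And>q'. sublinear q' \<Longrightarrow> (\<And>x. q' x \<le> q x) \<Longrightarrow> q' = q"
    using sublinear_minimal[OF p] by metis
  have neg: "q (- y) = - q y" for y
  proof -
    obtain q' where "sublinear q'" "\<And>x. q' x \<le> q x" "q' (- y) \<le> - q y"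
      using sublinear_improve[OF q(1)] by metis
    then have "q (- y) \<le> - q y" using min by metis
    then show ?thesis using sublinear_neg[OF q(1), of "- y"] by simp
  qed
  have add: "q (x + y) = q x + q y" for x y
    using sublinear_add[OF q(1), of x y] sublinear_add[OF q(1), of "- x" "- y"] neg[of x] neg[of y]
      neg[of "x + y"] by simp
  have scale: "q (r *\<^sub>R x) = r *\<^sub>R q x" for r x
  proof (cases "r = 0" "r > 0" rule: bool.exhaust[case_product bool.exhaust])
    case False_False
    then have "q ((- r) *\<^sub>R x) = (- r) * q x" by (intro sublinear_scale q) auto
    then show ?thesis using neg[of "r *\<^sub>R x"] by simp
  qed (use sublinear_scale[OF q(1)] sublinear_zero[OF q(1)] in auto)
  show ?thesis
    using that[of q] q(2) add scale by (blast intro: linearI)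
qed

lemma real_functional_attaining_norm:
  fixes y :: "'a::real_normed_vector"
  obtains f where "linear f" "\<And>x. f x \<le> norm x" "f y = norm y"
proof -
  have "sublinear (norm :: 'a \<Rightarrow> real)"
    by (auto simp: sublinear_def norm_triangle_ineq)
  then obtain q where q: "sublinear q" "\<And>x::'a. q x \<le> norm x" "q (- y) \<le> - norm y"
    using sublinear_improve by metis
  obtain f where f: "linear f" "\<And>x. f x \<le> q x"
    using linear_below_sublinear[OF q(1)] by metis
  have "norm y \<le> f y"
    using f(2)[of "- y"] q(3) linear_neg[OF f(1), of y] by simp
  then show ?thesis
    using that[OF f(1)] f(2) q(2) by (meson order_trans order_antisym)
qed

definition bounded_functional :: "('a::complex_banach_algebra \<Rightarrow> complex) \<Rightarrow> bool" where
  "bounded_functional \<phi> \<longleftrightarrow> bounded_linear \<phi> \<and> (\<forall>c x. \<phi> (c *\<^sub>C x) = c * \<phi> x)"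

text \<open>
  A real functional \<open>f\<close> is the real part of the complex functional \<open>x \<mapsto> f x - \<i> f (\<i> x)\<close>. The
  factor \<open>2\<close> in the bound is not sharp, but only its uniformity matters: it turns estimates
  of \<open>\<phi> (F z)\<close> that are uniform in \<open>\<phi>\<close> into estimates of the norm of \<open>F z\<close>.
\<close>

lemma functional_attaining_norm:
  fixes y :: "'a::complex_banach_algebra"
  obtains \<phi> where "bounded_functional \<phi>" "\<And>x. cmod (\<phi> x) \<le> 2 * norm x" "norm y \<le> cmod (\<phi> y)"
proof -
  obtain f where f: "linear f" "\<And>x::'a. f x \<le> norm x" "f y = norm y"
    using real_functional_attaining_norm by metis
  have absf: "\<bar>f x\<bar> \<le> norm x" for x
    using f(2)[of x] f(2)[of "- x"] linear_neg[OF f(1), of x] by simp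
  define \<phi> where "\<phi> x = of_real (f x) - \<i> * of_real (f (\<i> *\<^sub>C x))" for x
  have bound: "cmod (\<phi> x) \<le> 2 * norm x" for x
  proof -
    have "cmod (\<phi> x) \<le> \<bar>f x\<bar> + \<bar>f (\<i> *\<^sub>C x)\<bar>"
      unfolding \<phi>_def by (rule order_trans[OF norm_triangle_ineq4]) (simp add: norm_mult)
    also have "\<dots> \<le> norm x + norm (\<i> *\<^sub>C x)"
      by (intro add_mono absf)
    finally show ?thesis by (simp add: norm_scaleC)
  qed
  note f_lin = linear_add[OF f(1)] linear_scale[OF f(1)]
  have add: "\<phi> (x + x') = \<phi> x + \<phi> x'" for x x'
    by (simp add: \<phi>_def f_lin scaleC_add_right algebra_simps)
  have scale: "\<phi> (r *\<^sub>R x) = of_real r * \<phi> x" for r x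
    by (simp add: \<phi>_def f_lin scaleC_scaleR algebra_simps)
  have I: "\<phi> (\<i> *\<^sub>C x) = \<i> * \<phi> x" for x
    using linear_neg[OF f(1), of x] by (simp add: \<phi>_def scaleC_scaleC scaleC_minus_left algebra_simps)
  have "\<phi> (c *\<^sub>C x) = c * \<phi> x" for c x
  proof -
    have "c *\<^sub>C x = Re c *\<^sub>R x + Im c *\<^sub>R (\<i> *\<^sub>C x)"
      by (subst (1) complex_eq) (simp add: scaleC_add_left scaleR_scaleC scaleC_scaleC mult.commute
          flip: scaleC_of_real)
    then have "\<phi> (c *\<^sub>C x) = (of_real (Re c) + \<i> * of_real (Im c)) * \<phi> x"
      by (simp add: add scale I algebra_simps)
    then show ?thesis by (simp flip: complex_eq)
  qed
  moreover have "bounded_linear \<phi>"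
    using bound by (intro bounded_linear_intro[where K = 2])
      (simp_all add: add scale scaleR_conv_of_real[where 'a = complex] mult.commute)
  ultimately have "bounded_functional \<phi>" by (simp add: bounded_functional_def)
  moreover have "norm y \<le> cmod (\<phi> y)"
    using complex_Re_le_cmod[of "\<phi> y"] f(3) by (simp add: \<phi>_def)
  ultimately show ?thesis using that bound by blast
qed

lemma eqI_functional:
  fixes x y :: "'a::complex_banach_algebra"
  assumes "\<And>\<phi>. bounded_functional \<phi> \<Longrightarrow> \<phi> x = \<phi> y"
  shows "x = y"
proof -
  obtain \<phi> where \<phi>: "bounded_functional \<phi>" "norm (x - y) \<le> cmod (\<phi> (x - y))"
    using functional_attaining_norm by metis
  have "\<phi> (x - y) = \<phi> x - \<phi> y"
    using \<phi>(1) by (simp add: bounded_functional_def bounded_linear.linear linear_diff)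
  then show ?thesis using assms[OF \<phi>(1)] \<phi>(2) by simp
qed

section \<open>Inverses, the resolvent and the spectral radius\<close>

lemma ring_inverse_eqI:
  assumes "x * y = 1" "y * x = 1"
  shows "ring_inverse x = y"
  unfolding ring_inverse_def
proof (rule the_equality)
  fix z assume "x * z = 1 \<and> z * x = 1"
  then show "z = y" using assms by (metis mult.assoc mult_1_left mult_1_right)
qed (use assms in simp)

lemma is_invertibleI: "x * y = 1 \<Longrightarrow> y * x = 1 \<Longrightarrow> is_invertible x"
  by (auto simp: is_invertible_def)

lemma ring_inverse_right [simp]: "is_invertible x \<Longrightarrow> x * ring_inverse x = 1"
  and ring_inverse_left [simp]: "is_invertible x \<Longrightarrow> ring_inverse x * x = 1"
  by (auto simp: is_invertible_def ring_inverse_eqI)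

lemma ring_inverse_right_assoc [simp]: "is_invertible x \<Longrightarrow> x * (ring_inverse x * y) = y"
  and ring_inverse_left_assoc [simp]: "is_invertible x \<Longrightarrow> ring_inverse x * (x * y) = y"
  by (simp_all flip: mult.assoc)

lemma is_invertible_ring_inverse [simp]: "is_invertible x \<Longrightarrow> is_invertible (ring_inverse x)"
  by (rule is_invertibleI[of _ x]) auto

lemma is_invertible_one [simp]: "is_invertible 1"
  by (rule is_invertibleI[of _ 1]) auto

lemma ring_inverse_one [simp]: "ring_inverse 1 = 1"
  by (rule ring_inverse_eqI) auto

lemma is_invertible_mult [simp]:
  assumes "is_invertible x" "is_invertible y"
  shows "is_invertible (x * y)"
  using assms by (intro is_invertibleI[of _ "ring_inverse y * ring_inverse x"]) (simp_all add: mult.assoc)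

lemma ring_inverse_mult:
  assumes "is_invertible x" "is_invertible y"
  shows "ring_inverse (x * y) = ring_inverse y * ring_inverse x"
  using assms by (intro ring_inverse_eqI) (simp_all add: mult.assoc)

lemma is_invertible_minus [simp]: "is_invertible (- x) \<longleftrightarrow> is_invertible (x::'a::ring_1)"
proof -
  have "is_invertible (- x)" if "is_invertible x" for x :: 'a
    using that by (intro is_invertibleI[of _ "- ring_inverse x"]) simp_all
  from this[of x] this[of "- x"] show ?thesis by auto
qed

lemma is_invertibleI_one_sided:
  assumes "is_invertible (y * x)" "is_invertible (x * z)"
  shows "is_invertible x"
proof -
  define l where "l = ring_inverse (y * x) * y"
  define r where "r = z * ring_inverse (x * z)"
  have l: "l * x = 1" using assms(1) by (simp add: l_def mult.assoc)
  have r: "x * r = 1" using assms(2) by (simp add: r_def flip: mult.assoc)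
  have "l = r" by (metis l r mult.assoc mult_1_left mult_1_right)
  with l r show ?thesis by (auto intro: is_invertibleI)
qed

text \<open>
  The formal geometric series \<open>1 + y x + y x y x + \<dots> = 1 + y (1 + x y + \<dots>) x\<close> suggests the
  inverse.
\<close>

lemma is_invertible_one_minus_swap:
  assumes "is_invertible (1 - x * y)"
  shows "is_invertible (1 - y * (x::'a::ring_1))"
proof (rule is_invertibleI)
  let ?u = "ring_inverse (1 - x * y)"
  have 1: "x * y * ?u = ?u - 1" using ring_inverse_right[OF assms] by (simp add: algebra_simps)
  have 2: "?u * (x * y) = ?u - 1" using ring_inverse_left[OF assms] by (simp add: algebra_simps)
  have "(1 - y * x) * (1 + y * ?u * x) = 1 + y * ?u * x - y * x - y * (x * y * ?u) * x"
    by (simp add: algebra_simps)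
  also have "\<dots> = 1" unfolding 1 by (simp add: algebra_simps)
  finally show "(1 - y * x) * (1 + y * ?u * x) = 1" .
  have "(1 + y * ?u * x) * (1 - y * x) = 1 + y * ?u * x - y * x - y * (?u * (x * y)) * x"
    by (simp add: algebra_simps)
  also have "\<dots> = 1" unfolding 2 by (simp add: algebra_simps)
  finally show "(1 + y * ?u * x) * (1 - y * x) = 1" .
qed

lemma ring_inverse_commute:
  assumes "is_invertible x" "x * y = y * x"
  shows "ring_inverse x * y = y * ring_inverse x"
proof -
  have "ring_inverse x * y = ring_inverse x * (y * x) * ring_inverse x"
    using assms(1) by (simp add: mult.assoc)
  also have "\<dots> = y * ring_inverse x" using assms by (simp flip: assms(2))
  finally show ?thesis .
qed

lemma is_invertible_scaleC:
  assumes "c \<noteq> 0"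
  shows "is_invertible (c *\<^sub>C x) \<longleftrightarrow> is_invertible (x::'a::complex_banach_algebra)"
proof -
  have "is_invertible (c *\<^sub>C x)" if "c \<noteq> 0" "is_invertible x" for c and x :: 'a
    using that by (intro is_invertibleI[of _ "inverse c *\<^sub>C ring_inverse x"])
      (simp_all add: mult_scaleC_left mult_scaleC_right scaleC_scaleC)
  from this[of c x] this[of "inverse c" "c *\<^sub>C x"] assms show ?thesis
    by (auto simp: scaleC_scaleC)
qed

lemma power_scaleC: "(c *\<^sub>C (x::'a::complex_banach_algebra)) ^ n = (c ^ n) *\<^sub>C x ^ n"
  by (induction n) (simp_all add: mult_scaleC_left mult_scaleC_right scaleC_scaleC mult.commute)

text \<open>
  Domination of the powers of \<open>x\<close> by a geometric sequence is the algebraic form of the bound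
  \<open>r(x) \<le> s\<close> on the spectral radius. It can be estimated directly, and for
  sums of commuting elements the ratios add up.
\<close>

definition powers_dominated :: "'a::{real_normed_algebra,ring_1} \<Rightarrow> real \<Rightarrow> bool" where
  "powers_dominated x s \<longleftrightarrow> s \<ge> 0 \<and> (\<exists>M. \<forall>n. norm (x ^ n) \<le> M * s ^ n)"

lemma powers_dominatedE:
  assumes "powers_dominated x s"
  obtains M where "M > 0" "\<And>n. norm (x ^ n) \<le> M * s ^ n"
proof -
  obtain M where M: "\<And>n. norm (x ^ n) \<le> M * s ^ n" and "s \<ge> 0"
    using assms by (auto simp: powers_dominated_def)
  then have "norm (x ^ n) \<le> max M 1 * s ^ n" for n
    by (meson max.cobounded1 mult_right_mono order_trans zero_le_power)
  then show ?thesis using that[of "max M 1"] by simp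
qed

lemma powers_dominated_norm:
  assumes "norm x \<le> s"
  shows "powers_dominated (x::'a::{real_normed_algebra,ring_1}) s"
proof -
  have s: "s \<ge> 0" using assms norm_ge_zero order_trans by blast
  have "norm (x ^ n) \<le> norm (1::'a) * s ^ n" for n
  proof (induction n)
    case (Suc n)
    have "norm (x ^ Suc n) \<le> norm x * norm (x ^ n)" by (simp add: norm_mult_ineq)
    also have "\<dots> \<le> s * (norm (1::'a) * s ^ n)"
      using Suc assms s by (intro mult_mono) auto
    finally show ?case by (simp add: mult_ac)
  qed simp
  with s show ?thesis by (auto simp: powers_dominated_def)
qed

lemma powers_dominated_scaleC:
  assumes "powers_dominated (x::'a::complex_banach_algebra) s"
  shows "powers_dominated (c *\<^sub>C x) (cmod c * s)"
proof -
  obtain M where M: "\<And>n. norm (x ^ n) \<le> M * s ^ n" using assms powers_dominatedE by metis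
  have "norm ((c *\<^sub>C x) ^ n) \<le> M * (cmod c * s) ^ n" for n
  proof -
    have "norm ((c *\<^sub>C x) ^ n) = cmod c ^ n * norm (x ^ n)"
      by (simp add: power_scaleC norm_scaleC norm_power)
    also have "\<dots> \<le> cmod c ^ n * (M * s ^ n)" by (intro mult_left_mono M) auto
    finally show ?thesis by (simp add: power_mult_distrib mult_ac)
  qed
  then show ?thesis using assms by (auto simp: powers_dominated_def)
qed

lemma neumann_series:
  assumes "powers_dominated (x::'a::complex_banach_algebra) s" "s < 1"
  shows "is_invertible (1 - x)" "(\<lambda>n. x ^ n) sums ring_inverse (1 - x)"
proof -
  obtain M where M: "\<And>n. norm (x ^ n) \<le> M * s ^ n" using assms(1) powers_dominatedE by metis
  have s: "s \<ge> 0" using assms(1) by (simp add: powers_dominated_def)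
  have "summable (\<lambda>n. M * s ^ n)"
    using s assms(2) by (intro summable_mult summable_geometric) auto
  then have summ: "summable (\<lambda>n. x ^ n)"
    by (rule summable_comparison_test') (use M in auto)
  define y where "y = (\<Sum>n. x ^ n)"
  have y: "(\<lambda>n. x ^ n) sums y" using summ by (simp add: y_def summable_sums)
  have *: "(\<lambda>n. x ^ Suc n) sums (y - 1)" using y by (subst sums_Suc_iff) simp
  have "(\<lambda>n. x * x ^ n) sums (x * y)" by (rule bounded_linear.sums[OF bounded_linear_mult_right y])
  then have 1: "x * y = y - 1" using sums_unique2 * by simp
  have "(\<lambda>n. x ^ n * x) sums (y * x)" by (rule bounded_linear.sums[OF bounded_linear_mult_left y])
  then have 2: "y * x = y - 1" using sums_unique2 * by (simp add: power_commutes)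
  have "(1 - x) * y = 1" "y * (1 - x) = 1" using 1 2 by (simp_all add: algebra_simps)
  then show "is_invertible (1 - x)" "(\<lambda>n. x ^ n) sums ring_inverse (1 - x)"
    using y by (auto simp: ring_inverse_eqI intro: is_invertibleI)
qed

lemma not_in_spectrum_iff: "z \<notin> spectrum a \<longleftrightarrow> is_invertible (z *\<^sub>C 1 - a)"
  by (simp add: spectrum_def)

lemma is_invertible_diff_iff:
  assumes "z \<noteq> 0"
  shows "is_invertible (1 - inverse z *\<^sub>C a) \<longleftrightarrow> z \<notin> spectrum (a::'a::complex_banach_algebra)"
proof -
  have "z *\<^sub>C (1 - inverse z *\<^sub>C a) = z *\<^sub>C 1 - a"
    using assms by (simp add: scaleC_diff_right scaleC_scaleC)
  then show ?thesis using is_invertible_scaleC[OF assms] by (metis not_in_spectrum_iff)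
qed

lemma spectrum_subset_cball:
  assumes "powers_dominated (a::'a::complex_banach_algebra) s"
  shows "spectrum a \<subseteq> cball 0 s"
proof
  fix z assume z: "z \<in> spectrum a"
  show "z \<in> cball 0 s"
  proof (rule ccontr)
    assume "z \<notin> cball 0 s"
    then have "cmod z > s" by simp
    moreover have "s \<ge> 0" using assms by (simp add: powers_dominated_def)
    ultimately have "z \<noteq> 0" "s / cmod z < 1" by (auto simp: divide_less_eq_1)
    then have "cmod (inverse z) * s < 1" by (simp add: norm_inverse divide_inverse mult.commute)
    then have "z \<notin> spectrum a"
      using neumann_series(1)[OF powers_dominated_scaleC[OF assms]] is_invertible_diff_iff \<open>z \<noteq> 0\<close> by blast
    with z show False by simp
  qed
qed

lemma spectrum_bounded: "spectrum (a::'a::complex_banach_algebra) \<subseteq> cball 0 (norm a)"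
  by (rule spectrum_subset_cball) (simp add: powers_dominated_norm)

lemma eventually_near: "eventually (\<lambda>w. cmod (w - z) * C \<le> 1/2) (nhds z)"
proof -
  have "((\<lambda>w. cmod (w - z) * C) \<longlongrightarrow> cmod (z - z) * C) (nhds z)"
    by (intro tendsto_intros filterlim_ident)
  then have "eventually (\<lambda>w. cmod (w - z) * C < 1/2) (nhds z)"
    by (rule order_tendstoD) simp
  then show ?thesis by eventually_elim simp
qed

lemma spectrum_mult_swap:
  fixes x y :: "'a::complex_banach_algebra"
  assumes "z \<in> spectrum (x * y)" "z \<noteq> 0"
  shows "z \<in> spectrum (y * x)"
proof (rule ccontr)
  assume "z \<notin> spectrum (y * x)"
  then have "is_invertible (1 - (inverse z *\<^sub>C y) * x)"
    using is_invertible_diff_iff[OF assms(2), of "y * x"] by (simp add: mult_scaleC_left)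
  then have "is_invertible (1 - x * (inverse z *\<^sub>C y))" by (rule is_invertible_one_minus_swap)
  then show False
    using is_invertible_diff_iff[OF assms(2), of "x * y"] assms(1) by (simp add: mult_scaleC_right)
qed

lemma spectrum_mult_swap_ball:
  fixes x y :: "'a::complex_banach_algebra"
  assumes "spectrum (x * y) \<subseteq> ball 0 1"
  shows "spectrum (y * x) \<subseteq> ball 0 1"
proof
  fix z assume "z \<in> spectrum (y * x)"
  then show "z \<in> ball 0 1" using spectrum_mult_swap[of z y x] assms by (cases "z = 0") auto
qed

text \<open>
  Both the resolvent \<open>z \<mapsto> (z - a)\<^sup>-\<^sup>1\<close> and its inverted form
  \<open>w \<mapsto> (1 - w a)\<^sup>-\<^sup>1\<close> are inverses of affine functions of a complex variable; analyticity
  is established for all of these at once.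
\<close>

context
  fixes p q :: "'a::complex_banach_algebra"
begin

lemma affine_inverse_near:
  assumes inv: "is_invertible (p + z *\<^sub>C q)"
  defines "I \<equiv> ring_inverse (p + z *\<^sub>C q)"
  assumes small: "cmod (w - z) * norm (q * I) \<le> 1/2"
  shows "is_invertible (p + w *\<^sub>C q)"
    and "ring_inverse (p + w *\<^sub>C q) - I = (z - w) *\<^sub>C (ring_inverse (p + w *\<^sub>C q) * q * I)"
    and "norm (ring_inverse (p + w *\<^sub>C q) - I) \<le> 2 * norm I * norm (q * I) * cmod (w - z)"
proof -
  let ?J = "ring_inverse (p + w *\<^sub>C q)"
  have "(1 - (z - w) *\<^sub>C (q * I)) * (p + z *\<^sub>C q) =
      p + z *\<^sub>C q - (z - w) *\<^sub>C (q * (I * (p + z *\<^sub>C q)))"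
    by (simp add: left_diff_distrib mult_scaleC_left mult.assoc)
  also have "\<dots> = p + w *\<^sub>C q" using inv by (simp add: I_def scaleC_diff_left)
  finally have "(1 - (z - w) *\<^sub>C (q * I)) * (p + z *\<^sub>C q) = p + w *\<^sub>C q" .
  moreover have "is_invertible (1 - (z - w) *\<^sub>C (q * I))"
    using small by (intro neumann_series(1)[OF powers_dominated_norm[OF order.refl]])
      (simp add: norm_scaleC norm_minus_commute)
  ultimately show invw: "is_invertible (p + w *\<^sub>C q)" using inv is_invertible_mult by metis
  have "?J - I = ?J * ((p + z *\<^sub>C q) * I) - (?J * (p + w *\<^sub>C q)) * I"
    using inv invw by (simp add: I_def)
  also have "\<dots> = ?J * ((p + z *\<^sub>C q) - (p + w *\<^sub>C q)) * I"
    by (simp only: right_diff_distrib left_diff_distrib mult.assoc)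
  also have "\<dots> = (z - w) *\<^sub>C (?J * q * I)" by (simp add: scaleC_algebra_simps algebra_simps)
  finally show eq: "?J - I = (z - w) *\<^sub>C (?J * q * I)" .
  have le: "norm (?J - I) \<le> norm ?J * (cmod (w - z) * norm (q * I))"
  proof -
    have "norm (?J - I) = cmod (w - z) * norm (?J * (q * I))"
      by (simp add: eq norm_scaleC norm_minus_commute mult.assoc)
    also have "\<dots> \<le> cmod (w - z) * (norm ?J * norm (q * I))"
      by (intro mult_left_mono norm_mult_ineq) auto
    finally show ?thesis by (simp add: mult_ac)
  qed
  have "norm ?J \<le> norm I + norm (?J - I)" using norm_triangle_ineq[of I "?J - I"] by simp
  also have "norm (?J - I) \<le> norm ?J * (1/2)"
    by (rule order_trans[OF le]) (intro mult_left_mono small, simp)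
  finally have "norm ?J \<le> 2 * norm I" by simp
  then have "norm ?J * (cmod (w - z) * norm (q * I)) \<le> 2 * norm I * (cmod (w - z) * norm (q * I))"
    by (intro mult_right_mono) auto
  with le show "norm (?J - I) \<le> 2 * norm I * norm (q * I) * cmod (w - z)" by (simp add: mult_ac)
qed

lemma open_affine_invertible: "open {z. is_invertible (p + z *\<^sub>C q)}"
proof (subst open_subopen, clarify)
  fix z assume "is_invertible (p + z *\<^sub>C q)"
  then have "eventually (\<lambda>w. is_invertible (p + w *\<^sub>C q)) (nhds z)"
    using eventually_near[of z] affine_inverse_near(1) by (rule_tac eventually_mono) blast+
  then show "\<exists>T. open T \<and> z \<in> T \<and> T \<subseteq> {z. is_invertible (p + z *\<^sub>C q)}"
    by (auto simp: eventually_nhds)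
qed

lemma isCont_affine_inverse:
  assumes "is_invertible (p + z *\<^sub>C q)"
  shows "isCont (\<lambda>z. ring_inverse (p + z *\<^sub>C q)) z"
proof -
  let ?I = "ring_inverse (p + z *\<^sub>C q)"
  let ?b = "\<lambda>w. 2 * norm ?I * norm (q * ?I) * cmod (w - z)"
  have "((\<lambda>w. ring_inverse (p + w *\<^sub>C q) - ?I) \<longlongrightarrow> 0) (at z)"
  proof (rule Lim_null_comparison)
    show "eventually (\<lambda>w. norm (ring_inverse (p + w *\<^sub>C q) - ?I) \<le> ?b w) (at z)"
      using eventually_near[of z "norm (q * ?I)"] affine_inverse_near(3)[OF assms]
      by (auto simp: eventually_at_filter elim: eventually_mono)
    have "(?b \<longlongrightarrow> ?b z) (at z)" by (intro tendsto_intros)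
    then show "(?b \<longlongrightarrow> 0) (at z)" by simp
  qed
  then show ?thesis by (simp add: isCont_def LIM_zero_iff)
qed

lemma continuous_on_affine_inverse:
  "(\<And>z. z \<in> S \<Longrightarrow> is_invertible (p + z *\<^sub>C q)) \<Longrightarrow> continuous_on S (\<lambda>z. ring_inverse (p + z *\<^sub>C q))"
  by (intro continuous_at_imp_continuous_on ballI isCont_affine_inverse)

lemma holomorphic_affine_inverse:
  assumes \<phi>: "bounded_functional \<phi>" and S: "\<And>z. z \<in> S \<Longrightarrow> is_invertible (p + z *\<^sub>C q)"
  shows "(\<lambda>z. \<phi> (ring_inverse (p + z *\<^sub>C q))) holomorphic_on S"
proof -
  have bl: "bounded_linear \<phi>" and \<phi>C: "\<And>c x. \<phi> (c *\<^sub>C x) = c * \<phi> x"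
    using \<phi> by (auto simp: bounded_functional_def)
  have "((\<lambda>z. \<phi> (ring_inverse (p + z *\<^sub>C q))) has_field_derivative
      - \<phi> (ring_inverse (p + z *\<^sub>C q) * q * ring_inverse (p + z *\<^sub>C q))) (at z)" if "z \<in> S" for z
  proof -
    let ?I = "ring_inverse (p + z *\<^sub>C q)"
    have inv: "is_invertible (p + z *\<^sub>C q)" using S that .
    have "((\<lambda>w. ring_inverse (p + w *\<^sub>C q)) \<longlongrightarrow> ?I) (at z)"
      using isCont_affine_inverse[OF inv] by (simp add: isCont_def)
    then have "((\<lambda>w. - \<phi> (ring_inverse (p + w *\<^sub>C q) * q * ?I)) \<longlongrightarrow> - \<phi> (?I * q * ?I)) (at z)"
      by (intro tendsto_intros bounded_linear.tendsto[OF bl])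
    moreover have "eventually (\<lambda>w. - \<phi> (ring_inverse (p + w *\<^sub>C q) * q * ?I) =
        (\<phi> (ring_inverse (p + w *\<^sub>C q)) - \<phi> ?I) / (w - z)) (at z)"
    proof -
      have "- \<phi> (ring_inverse (p + w *\<^sub>C q) * q * ?I) =
          (\<phi> (ring_inverse (p + w *\<^sub>C q)) - \<phi> ?I) / (w - z)"
        if "cmod (w - z) * norm (q * ?I) \<le> 1/2" "w \<noteq> z" for w
      proof -
        have "\<phi> (ring_inverse (p + w *\<^sub>C q)) - \<phi> ?I = \<phi> (ring_inverse (p + w *\<^sub>C q) - ?I)"
          using bl by (simp add: bounded_linear.linear linear_diff)
        also have "\<dots> = (z - w) * \<phi> (ring_inverse (p + w *\<^sub>C q) * q * ?I)"
          using affine_inverse_near(2)[OF inv that(1)] by (simp add: \<phi>C)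
        finally show ?thesis using that(2) by (simp add: field_simps)
      qed
      then show ?thesis using eventually_near[of z "norm (q * ?I)"]
        by (auto simp: eventually_at_filter elim: eventually_mono)
    qed
    ultimately show ?thesis by (simp add: has_field_derivative_iff tendsto_cong)
  qed
  then show ?thesis by (meson field_differentiable_at_within field_differentiable_def holomorphic_onI)
qed

end

abbreviation resolvent :: "'a::complex_banach_algebra \<Rightarrow> complex \<Rightarrow> 'a" where
  "resolvent a z \<equiv> ring_inverse (z *\<^sub>C 1 - a)"

lemma open_resolvent_set: "open (- spectrum (a::'a::complex_banach_algebra))"
proof -
  have "- spectrum a = {z. is_invertible (- a + z *\<^sub>C 1)}" by (auto simp: spectrum_def)
  then show ?thesis using open_affine_invertible by metis
qed

lemma continuous_on_resolvent:
  assumes "S \<inter> spectrum (a::'a::complex_banach_algebra) = {}"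
  shows "continuous_on S (resolvent a)"
proof -
  have "continuous_on S (\<lambda>z. ring_inverse (- a + z *\<^sub>C 1))"
    using assms by (intro continuous_on_affine_inverse) (auto simp: spectrum_def)
  then show ?thesis by simp
qed

lemma holomorphic_on_resolvent:
  assumes "bounded_functional \<phi>" "S \<inter> spectrum (a::'a::complex_banach_algebra) = {}"
  shows "(\<lambda>z. \<phi> (resolvent a z)) holomorphic_on S"
proof -
  have "(\<lambda>z. \<phi> (ring_inverse (- a + z *\<^sub>C 1))) holomorphic_on S"
    using assms(2) by (intro holomorphic_affine_inverse assms(1)) (auto simp: spectrum_def)
  then show ?thesis by simp
qed

text \<open>
  The spectral radius formula. Applied to a functional whose value at \<open>x ^ n\<close> is at least
  the norm of \<open>x ^ n\<close>, Cauchy's inequality for the Taylor coefficients of \<open>w \<mapsto> (1 - w x)\<^sup>-\<^sup>1\<close> bounds that norm by a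
  constant that does not depend on the functional.
\<close>

lemma powers_dominated_of_spectrum:
  fixes x :: "'a::complex_banach_algebra"
  assumes spec: "spectrum x \<subseteq> ball 0 s" and s: "s > 0"
  obtains t where "0 < t" "t < s" "powers_dominated x t"
proof -
  define Q where "Q w = ring_inverse (1 + w *\<^sub>C (- x))" for w
  have Qdef: "Q w = ring_inverse (1 - w *\<^sub>C x)" for w by (simp add: Q_def scaleC_minus_right)
  define S where "S = {w. is_invertible (1 + w *\<^sub>C (- x))}"
  have "cball 0 (1/s) \<subseteq> S"
  proof
    fix w :: complex assume w: "w \<in> cball 0 (1/s)"
    show "w \<in> S"
    proof (cases "w = 0")
      case False
      have "cmod (inverse w) \<ge> s" 
        using w False s by (simp add: norm_inverse le_divide_eq divide_inverse[symmetric] inverse_eq_divide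
            norm_divide mult.commute)
      then have "inverse w \<notin> spectrum x" using spec by auto
      then show ?thesis
        using is_invertible_diff_iff[of "inverse w" x] False by (simp add: S_def scaleC_minus_right)
    qed (simp add: S_def)
  qed
  moreover have "open S" unfolding S_def by (rule open_affine_invertible)
  ultimately obtain e where e: "e > 0" "(\<Union>w\<in>cball 0 (1/s). cball w e) \<subseteq> S"
    using compact_subset_open_imp_cball_epsilon_subset[of "cball 0 (1/s)" S] by auto
  \<comment> \<open>The transformed resolvent is analytic on a disc of radius larger than \<open>1 / s\<close>.\<close>
  define \<rho> where "\<rho> = 1/s + e"
  have \<rho>: "\<rho> > 0" using s e(1) by (simp add: \<rho>_def add_pos_pos)
  have "1 / \<rho> < 1 / (1 / s)"
    using s e(1) \<rho> by (intro divide_strict_left_mono) (auto simp: \<rho>_def)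
  then have \<rho>s: "1 / \<rho> < s" by simp
  have "cball 0 \<rho> \<subseteq> S"
  proof
    fix w :: complex assume w: "w \<in> cball 0 \<rho>"
    \<comment> \<open>The point of the smaller disc on the ray through \<open>w\<close>, which is within distance \<open>e\<close> of \<open>w\<close>.\<close>
    let ?v = "of_real (1 / (s * \<rho>)) * w"
    have "cmod ?v = cmod w / (s * \<rho>)" using s \<rho> by (simp add: norm_mult norm_divide)
    also have "\<dots> \<le> \<rho> / (s * \<rho>)" using w s \<rho> by (intro divide_right_mono) auto
    finally have v: "cmod ?v \<le> 1 / s" using s \<rho> by (simp add: field_simps)
    have "w - ?v = of_real (1 - 1 / (s * \<rho>)) * w" by (simp add: algebra_simps)
    also have "1 - 1 / (s * \<rho>) = e / \<rho>"
    proof -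
      have "1 - 1 / (s * \<rho>) = (s * \<rho> - 1) / (s * \<rho>)"
        using s \<rho> by (simp add: diff_divide_distrib)
      also have "s * \<rho> - 1 = s * e" using s by (simp add: \<rho>_def distrib_left)
      finally show ?thesis using s by simp
    qed
    finally have "cmod (w - ?v) = e / \<rho> * cmod w" using e \<rho> by (simp add: norm_mult norm_divide)
    also have "\<dots> \<le> e / \<rho> * \<rho>" using w e \<rho> by (intro mult_left_mono) auto
    finally have "cmod (?v - w) \<le> e" using \<rho> by (simp add: norm_minus_commute)
    then have "w \<in> cball ?v e" by (simp add: dist_norm)
    moreover have "?v \<in> cball 0 (1 / s)" using v by simp
    ultimately show "w \<in> S" using e(2) by blast
  qed
  then have inv: "is_invertible (1 + w *\<^sub>C (- x))" if "cmod w \<le> \<rho>" for w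
    using that by (auto simp: S_def subset_iff)
  have contQ: "continuous_on (cball 0 \<rho>) Q"
    unfolding Q_def by (intro continuous_on_affine_inverse inv) simp
  then have "bounded (Q ` cball 0 \<rho>)"
    by (intro compact_imp_bounded compact_continuous_image) auto
  then obtain B where B: "\<And>w. w \<in> cball 0 \<rho> \<Longrightarrow> norm (Q w) \<le> B"
    unfolding bounded_iff by blast
  have "norm (x ^ n) \<le> (2 * B) * (1 / \<rho>) ^ n" for n
  proof -
    obtain \<phi> where \<phi>: "bounded_functional \<phi>" "\<And>y. cmod (\<phi> y) \<le> 2 * norm y"
        "norm (x ^ n) \<le> cmod (\<phi> (x ^ n))"
      using functional_attaining_norm by metis
    have bl: "bounded_linear \<phi>" and \<phi>C: "\<And>c x. \<phi> (c *\<^sub>C x) = c * \<phi> x"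
      using \<phi>(1) by (auto simp: bounded_functional_def)
    have "(\<lambda>w. \<phi> (Q w)) has_fps_expansion Abs_fps (\<lambda>n. \<phi> (x ^ n))"
    proof (rule has_fps_expansionI)
      have "(\<lambda>n. fps_nth (Abs_fps (\<lambda>n. \<phi> (x ^ n))) n * w ^ n) sums \<phi> (Q w)"
        if "cmod (w - 0) * norm x \<le> 1/2" for w
      proof -
        have "(\<lambda>n. (w *\<^sub>C x) ^ n) sums Q w"
          unfolding Qdef by (rule neumann_series(2)[OF powers_dominated_norm[OF order.refl]])
            (use that in \<open>simp add: norm_scaleC\<close>)
        then have "(\<lambda>n. \<phi> ((w *\<^sub>C x) ^ n)) sums \<phi> (Q w)" by (rule bounded_linear.sums[OF bl])
        then show ?thesis by (simp add: power_scaleC \<phi>C mult.commute)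
      qed
      then show "eventually (\<lambda>w. (\<lambda>n. fps_nth (Abs_fps (\<lambda>n. \<phi> (x ^ n))) n * w ^ n) sums \<phi> (Q w)) (nhds 0)"
        using eventually_near[of 0 "norm x"] by (auto elim: eventually_mono)
    qed
    then have coeff: "\<phi> (x ^ n) = (deriv ^^ n) (\<lambda>w. \<phi> (Q w)) 0 / fact n"
      using fps_nth_fps_expansion by fastforce
    have "cmod ((deriv ^^ n) (\<lambda>w. \<phi> (Q w)) 0) \<le> fact n * (2 * B) / \<rho> ^ n"
    proof (rule Cauchy_inequality)
      show "(\<lambda>w. \<phi> (Q w)) holomorphic_on ball 0 \<rho>"
        unfolding Q_def by (intro holomorphic_affine_inverse \<phi>(1) inv) simp
      show "continuous_on (cball 0 \<rho>) (\<lambda>w. \<phi> (Q w))"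
        by (rule bounded_linear.continuous_on[OF bl contQ])
      show "\<rho> > 0" by fact
      show "cmod (\<phi> (Q w)) \<le> 2 * B" if "cmod (0 - w) = \<rho>" for w
        using \<phi>(2)[of "Q w"] B[of w] that by simp
    qed
    then have "cmod (\<phi> (x ^ n)) \<le> 2 * B / \<rho> ^ n"
      by (simp add: coeff norm_divide field_simps)
    with \<phi>(3) show ?thesis by (simp add: field_simps)
  qed
  then have "powers_dominated x (1 / \<rho>)" using \<rho> by (auto simp: powers_dominated_def)
  then show ?thesis using that[of "1 / \<rho>"] \<rho> \<rho>s by simp
qed

text \<open>
  If the spectrum were empty, the resolvent would be entire; its decay at infinity makes
  Liouville's theorem applicable.
\<close>

lemma resolvent_tendsto_0:
  "((\<lambda>z. resolvent (a::'a::complex_banach_algebra) z) \<longlongrightarrow> 0) at_infinity"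
proof (rule Lim_null_comparison)
  let ?b = "\<lambda>z. norm (1::'a) / (cmod z - norm a)"
  have "norm (resolvent a z) \<le> ?b z" if "cmod z > norm a" for z
  proof -
    have "z \<notin> spectrum a" using spectrum_bounded[of a] that by auto
    then have "(z *\<^sub>C 1 - a) * resolvent a z = 1" by (simp add: not_in_spectrum_iff)
    then have "z *\<^sub>C resolvent a z = 1 + a * resolvent a z"
      by (simp add: left_diff_distrib mult_scaleC_left algebra_simps)
    then have "cmod z * norm (resolvent a z) = norm (1 + a * resolvent a z)"
      by (simp flip: norm_scaleC)
    also have "\<dots> \<le> norm (1::'a) + norm a * norm (resolvent a z)"
      by (intro order_trans[OF norm_triangle_ineq] add_left_mono norm_mult_ineq)
    finally show ?thesis using that by (simp add: field_simps)
  qed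
  then show "eventually (\<lambda>z. norm (resolvent a z) \<le> ?b z) at_infinity"
    unfolding eventually_at_infinity by (intro exI[of _ "norm a + 1"]) auto
  have "filterlim (\<lambda>z. - norm a + cmod z) at_top at_infinity"
    by (intro filterlim_tendsto_add_at_top[OF tendsto_const] filterlim_norm_at_top)
  then have "((\<lambda>z::complex. norm (1::'a) / (- norm a + cmod z)) \<longlongrightarrow> 0) at_infinity"
    by (intro tendsto_divide_0[OF tendsto_const] filterlim_at_top_imp_at_infinity)
  then show "(?b \<longlongrightarrow> 0) at_infinity" by simp
qed

lemma spectrum_nonempty: "spectrum (a::'a::complex_banach_algebra) \<noteq> {}"
proof
  assume empty: "spectrum a = {}"
  have "resolvent a 0 = 0"
  proof (rule eqI_functional)
    fix \<phi> :: "'a \<Rightarrow> complex" assume \<phi>: "bounded_functional \<phi>"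
    then have bl: "bounded_linear \<phi>" by (simp add: bounded_functional_def)
    have 0: "\<phi> 0 = 0" using bl by (simp add: bounded_linear.linear linear_0)
    have "((\<lambda>z. \<phi> (resolvent a z)) \<longlongrightarrow> 0) at_infinity"
      using bounded_linear.tendsto[OF bl resolvent_tendsto_0[of a]] 0 by simp
    moreover have "(\<lambda>z. \<phi> (resolvent a z)) holomorphic_on UNIV"
      using empty by (intro holomorphic_on_resolvent \<phi>) simp
    ultimately have "\<phi> (resolvent a 0) = 0" by (intro Liouville_weak_0)
    then show "\<phi> (resolvent a 0) = \<phi> 0" using 0 by simp
  qed
  then have "(0 *\<^sub>C 1 - a) * 0 = (1::'a)"
    using ring_inverse_right[of "0 *\<^sub>C 1 - a"] not_in_spectrum_iff[of 0 a] empty by simp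
  then show False by simp
qed

section \<open>Contour integrals of algebra-valued functions\<close>

lemma bounded_functional_linear:
  assumes "bounded_functional \<phi>"
  shows "bounded_linear \<phi>" "\<phi> (x + y) = \<phi> x + \<phi> y" "\<phi> (x - y) = \<phi> x - \<phi> y"
    "\<phi> (c *\<^sub>C x) = c * \<phi> x" "\<phi> (r *\<^sub>R x) = of_real r * \<phi> x" "\<phi> 0 = 0"
proof -
  show bl: "bounded_linear \<phi>" and "\<phi> (c *\<^sub>C x) = c * \<phi> x"
    using assms by (auto simp: bounded_functional_def)
  show "\<phi> (x + y) = \<phi> x + \<phi> y" "\<phi> (x - y) = \<phi> x - \<phi> y" "\<phi> (r *\<^sub>R x) = of_real r * \<phi> x"
      "\<phi> 0 = 0"
    using bl by (simp_all add: bounded_linear.linear linear_add linear_diff linear_scale linear_0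
        scaleR_conv_of_real[where 'a = complex])
qed

text \<open>
  Analyticity is tested on functionals, so that Cauchy's theorem is needed for complex-valued
  functions only.
\<close>

definition weakly_holomorphic_on ::
    "(complex \<Rightarrow> 'a::complex_banach_algebra) \<Rightarrow> complex set \<Rightarrow> bool" where
  "weakly_holomorphic_on F S \<longleftrightarrow>
     continuous_on S F \<and> (\<forall>\<phi>. bounded_functional \<phi> \<longrightarrow> (\<lambda>z. \<phi> (F z)) holomorphic_on S)"

lemma weakly_holomorphic_on_subset:
  "weakly_holomorphic_on F S \<Longrightarrow> T \<subseteq> S \<Longrightarrow> weakly_holomorphic_on F T"
  unfolding weakly_holomorphic_on_def using continuous_on_subset holomorphic_on_subset by blast

definition alg_contour_integrable ::
    "(real \<Rightarrow> complex) \<Rightarrow> (complex \<Rightarrow> 'a::complex_banach_algebra) \<Rightarrow> bool" where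
  "alg_contour_integrable \<gamma> F \<longleftrightarrow>
     (\<lambda>t. vector_derivative \<gamma> (at t within {0..1}) *\<^sub>C F (\<gamma> t)) integrable_on {0..1}"

lemma functional_alg_contour_integral:
  assumes \<phi>: "bounded_functional \<phi>" and "alg_contour_integrable \<gamma> F"
  shows "((\<lambda>z. \<phi> (F z)) has_contour_integral \<phi> (alg_contour_integral \<gamma> F)) \<gamma>"
proof -
  have "((\<lambda>t. vector_derivative \<gamma> (at t within {0..1}) *\<^sub>C F (\<gamma> t)) has_integral
      alg_contour_integral \<gamma> F) {0..1}"
    using assms(2) by (simp add: alg_contour_integrable_def alg_contour_integral_def integrable_integral)
  from has_integral_linear[OF this bounded_functional_linear(1)[OF \<phi>]] show ?thesis
    by (simp add: has_contour_integral_def o_def bounded_functional_linear(4)[OF \<phi>] mult.commute)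
qed

lemma alg_contour_integrable_linepath:
  fixes F :: "complex \<Rightarrow> 'a::complex_banach_algebra"
  assumes "continuous_on (closed_segment a b) F"
  shows "alg_contour_integrable (linepath a b) F"
proof -
  have "continuous_on {0..1} (\<lambda>t. F (linepath a b t))"
    by (rule continuous_on_compose2[OF assms]) (auto simp: continuous_on_linepath linepath_in_path)
  then have "(\<lambda>t. (b - a) *\<^sub>C F (linepath a b t)) integrable_on {0..1}"
    by (intro integrable_continuous_interval continuous_intros)
  then show ?thesis
    unfolding alg_contour_integrable_def
    by (rule integrable_eq) (simp add: vector_derivative_linepath_within)
qed

text \<open>
  A weakly holomorphic function has a primitive on discs. The estimate of its difference quotient
  is checked on one functional at a time, with a bound that does not depend on the functional.
\<close>

lemma local_primitive:
  fixes F :: "complex \<Rightarrow> 'a::complex_banach_algebra"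
  assumes F: "weakly_holomorphic_on F (ball c r)"
  obtains G where "\<And>w. w \<in> ball c r \<Longrightarrow> (G has_derivative (\<lambda>h. h *\<^sub>C F w)) (at w)"
proof
  define G where "G z = alg_contour_integral (linepath c z) F" for z
  fix w assume w: "w \<in> ball c r"
  have contF: "continuous_on (ball c r) F" using F by (simp add: weakly_holomorphic_on_def)
  have seg: "closed_segment u z \<subseteq> ball c r" if "u \<in> ball c r" "z \<in> ball c r" for u z
    using that by (simp add: closed_segment_subset)
  have c: "c \<in> ball c r" using w by (auto intro: le_less_trans[OF zero_le_dist])
  show "(G has_derivative (\<lambda>h. h *\<^sub>C F w)) (at w)"
    unfolding has_derivative_at_alt
  proof (intro conjI allI impI)
    show "bounded_linear (\<lambda>h. h *\<^sub>C F w)"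
      by (rule bounded_bilinear.bounded_linear_left[OF bounded_bilinear_scaleC])
    fix e :: real assume e: "e > 0"
    have "isCont F w" using contF w by (simp add: continuous_on_eq_continuous_at)
    then obtain d1 where d1: "d1 > 0" "\<And>y. dist y w < d1 \<Longrightarrow> dist (F y) (F w) < e / 2"
      using e unfolding continuous_at_eps_delta by (meson half_gt_zero)
    obtain d2 where d2: "d2 > 0" "ball w d2 \<subseteq> ball c r"
      using w open_contains_ball[of "ball c r"] open_ball by blast
    have "norm (G y - G w - (y - w) *\<^sub>C F w) \<le> e * norm (y - w)"
      if y: "norm (y - w) < min d1 d2" for y
    proof -
      have yb: "y \<in> ball c r" using y d2 by (auto simp: dist_norm norm_minus_commute)
      obtain \<phi> where \<phi>: "bounded_functional \<phi>" "\<And>x. cmod (\<phi> x) \<le> 2 * norm x"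
          "norm (G y - G w - (y - w) *\<^sub>C F w) \<le> cmod (\<phi> (G y - G w - (y - w) *\<^sub>C F w))"
        using functional_attaining_norm by metis
      note lin = bounded_functional_linear[OF \<phi>(1)]
      have "(\<lambda>z. \<phi> (F z)) holomorphic_on ball c r"
        using F \<phi>(1) by (simp add: weakly_holomorphic_on_def)
      then obtain H where H: "\<And>z. z \<in> ball c r \<Longrightarrow>
          (H has_field_derivative \<phi> (F z)) (at z within ball c r)"
        using holomorphic_convex_primitive'[OF convex_ball open_ball] by metis
      have int: "((\<lambda>z. \<phi> (F z)) has_contour_integral (H z - H u)) (linepath u z)"
        if "u \<in> ball c r" "z \<in> ball c r" for u z
        using contour_integral_primitive[OF H, of "linepath u z"] seg[OF that] by simp
      have \<phi>G: "\<phi> (G z) = H z - H c" if z: "z \<in> ball c r" for z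
        unfolding G_def
      proof (rule has_contour_integral_unique[OF functional_alg_contour_integral[OF \<phi>(1)]])
        show "alg_contour_integrable (linepath c z) F"
          by (intro alg_contour_integrable_linepath continuous_on_subset[OF contF seg[OF c z]])
      qed (rule int[OF c z])
      have "((\<lambda>z. \<phi> (F z) - \<phi> (F w)) has_contour_integral
          (H y - H w - \<phi> (F w) * (y - w))) (linepath w y)"
        by (intro has_contour_integral_diff int w yb has_contour_integral_const_linepath)
      then have "cmod (H y - H w - \<phi> (F w) * (y - w)) \<le> e * cmod (y - w)"
      proof (rule has_contour_integral_bound_linepath)
        fix z assume "z \<in> closed_segment w y"
        then have "dist z w < d1"
          using y segment_bound(1)[of z w y] by (simp add: dist_norm norm_minus_commute)
        have "cmod (\<phi> (F z) - \<phi> (F w)) \<le> 2 * dist (F z) (F w)"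
          using \<phi>(2)[of "F z - F w"] by (simp add: lin dist_norm)
        with d1(2)[OF \<open>dist z w < d1\<close>] show "cmod (\<phi> (F z) - \<phi> (F w)) \<le> e" by simp
      qed (use e in simp)
      moreover have "\<phi> (G y - G w - (y - w) *\<^sub>C F w) = H y - H w - \<phi> (F w) * (y - w)"
        by (simp add: lin \<phi>G[OF w] \<phi>G[OF yb] mult.commute)
      ultimately show ?thesis using \<phi>(3) by simp
    qed
    then show "\<exists>d>0. \<forall>y. norm (y - w) < d \<longrightarrow> norm (G y - G w - (y - w) *\<^sub>C F w) \<le> e * norm (y - w)"
      using d1(1) d2(1) by (intro exI[of _ "min d1 d2"]) auto
  qed
qed

text \<open>
  The derivative of a valid path may be unbounded near the finitely many corners, so continuity of
  the integrand is not enough for integrability. Local primitives and the fundamental theorem of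
  calculus, which tolerates finitely many exceptional points, give it nevertheless.
\<close>

lemma alg_contour_integrable_weakly_holomorphic:
  fixes F :: "complex \<Rightarrow> 'a::complex_banach_algebra"
  assumes F: "weakly_holomorphic_on F S" and S: "open S"
    and \<gamma>: "valid_path \<gamma>" "path_image \<gamma> \<subseteq> S"
  shows "alg_contour_integrable \<gamma> F"
proof -
  obtain k D where k: "finite k" and D: "\<And>t. t \<in> {0..1} - k \<Longrightarrow> (\<gamma> has_vector_derivative D t) (at t)"
    and cont: "continuous_on {0..1} \<gamma>"
    using \<gamma>(1) unfolding valid_path_def piecewise_C1_differentiable_on_def C1_differentiable_on_def
    by blast
  let ?f = "\<lambda>t. vector_derivative \<gamma> (at t within {0..1}) *\<^sub>C F (\<gamma> t)"
  have "\<exists>d>0. \<forall>u v. x \<in> cbox u v \<and> cbox u v \<subseteq> ball x d \<and> cbox u v \<subseteq> cbox 0 1 \<longrightarrow>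
      ?f integrable_on cbox u v" if x: "x \<in> cbox 0 1" for x :: real
  proof -
    have "\<gamma> x \<in> S" using x \<gamma>(2) by (auto simp: path_image_def)
    then obtain r where r: "r > 0" "ball (\<gamma> x) r \<subseteq> S" using S open_contains_ball by blast
    obtain G where G: "\<And>w. w \<in> ball (\<gamma> x) r \<Longrightarrow> (G has_derivative (\<lambda>h. h *\<^sub>C F w)) (at w)"
      using local_primitive[OF weakly_holomorphic_on_subset[OF F r(2)]] by blast
    obtain d where d: "d > 0" "\<And>y. y \<in> {0..1} \<Longrightarrow> dist y x < d \<Longrightarrow> dist (\<gamma> y) (\<gamma> x) < r"
      using cont x r(1) unfolding continuous_on_iff by (metis cbox_interval)
    have "?f integrable_on cbox u v"
      if uv: "x \<in> cbox u v" "cbox u v \<subseteq> ball x d" "cbox u v \<subseteq> cbox 0 1" for u v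
    proof -
      have in_ball: "\<gamma> t \<in> ball (\<gamma> x) r" if "t \<in> {u..v}" for t
        using that uv(2,3) d(2)[of t] by (auto simp: dist_commute subset_iff)
      have le: "u \<le> v" and sub: "{u..v} \<subseteq> {0..1}" using uv by auto
      have "(?f has_integral (G (\<gamma> v) - G (\<gamma> u))) {u..v}"
      proof (rule fundamental_theorem_of_calculus_interior_strong[OF k le, where f = "\<lambda>t. G (\<gamma> t)"])
        fix t assume t: "t \<in> {u<..<v} - k"
        have t01: "0 < t" "t < 1" using t sub le by auto
        have "t \<in> {0..1} - k" using t t01 by simp
        from D[OF this] have der: "(\<gamma> has_vector_derivative D t) (at t)" .
        then have "(\<gamma> has_vector_derivative D t) (at t within {0..1})"
          by (rule has_vector_derivative_at_within)
        then have vd: "vector_derivative \<gamma> (at t within {0..1}) = D t"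
          using t01 by (intro vector_derivative_within_closed_interval) auto
        have "(G has_derivative (\<lambda>h. h *\<^sub>C F (\<gamma> t))) (at (\<gamma> t))"
          using t by (intro G in_ball) auto
        from diff_chain_at[OF der[unfolded has_vector_derivative_def] this]
        show "((\<lambda>t. G (\<gamma> t)) has_vector_derivative ?f t) (at t)"
          by (simp add: has_vector_derivative_def o_def vd bounded_bilinear.scaleR_left[OF bounded_bilinear_scaleC])
      next
        have "isCont G (\<gamma> t)" if "t \<in> {u..v}" for t
          using G[OF in_ball[OF that]] has_derivative_continuous by blast
        then have "continuous_on (\<gamma> ` {u..v}) G" by (auto intro: continuous_at_imp_continuous_on)
        then show "continuous_on {u..v} (\<lambda>t. G (\<gamma> t))"
          by (rule continuous_on_compose2[OF _ continuous_on_subset[OF cont sub]]) auto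
      qed
      then show ?thesis by (auto simp: has_integral_integrable)
    qed
    with d(1) show ?thesis by blast
  qed
  then show ?thesis
    unfolding alg_contour_integrable_def using integrable_on_little_subintervals[of 0 1 ?f] by simp
qed

section \<open>Integrals of the resolvent\<close>

lemma valid_path_inversion:
  assumes "valid_path \<gamma>" "(\<mu>::complex) \<notin> path_image \<gamma>"
  shows "valid_path ((\<lambda>z. 1 / (z - \<mu>)) \<circ> \<gamma>)"
  by (rule valid_path_compose_holomorphic[where S = "- {\<mu>}"])
     (use assms in \<open>auto intro!: holomorphic_intros\<close>)

lemma contour_integral_inversion:
  assumes "valid_path \<gamma>" "\<mu> \<notin> path_image \<gamma>"
  shows "contour_integral ((\<lambda>z. 1 / (z - \<mu>)) \<circ> \<gamma>) h =
    contour_integral \<gamma> (\<lambda>z. - h (1 / (z - \<mu>)) / (z - \<mu>)\<^sup>2)"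
proof -
  have "contour_integral ((\<lambda>z. 1 / (z - \<mu>)) \<circ> \<gamma>) h =
      contour_integral \<gamma> (\<lambda>z. deriv (\<lambda>z. 1 / (z - \<mu>)) z * h (1 / (z - \<mu>)))"
    by (rule contour_integral_comp_analyticW[where s = "- {\<mu>}"])
       (use assms in \<open>auto intro!: analytic_intros\<close>)
  also have "\<dots> = contour_integral \<gamma> (\<lambda>z. - h (1 / (z - \<mu>)) / (z - \<mu>)\<^sup>2)"
  proof (rule contour_integral_cong)
    fix z assume "z \<in> path_image \<gamma>"
    then have "z \<noteq> \<mu>" using assms(2) by auto
    then have "((\<lambda>z. 1 / (z - \<mu>)) has_field_derivative - 1 / (z - \<mu>)\<^sup>2) (at z)"
      by (auto intro!: derivative_eq_intros simp: power2_eq_square)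
    then show "deriv (\<lambda>z. 1 / (z - \<mu>)) z * h (1 / (z - \<mu>)) = - h (1 / (z - \<mu>)) / (z - \<mu>)\<^sup>2"
      by (simp add: DERIV_imp_deriv)
  qed simp
  finally show ?thesis .
qed

text \<open>
  The Cauchy kernel transformed by the inversion decomposes into the kernels at \<open>k\<close> and at the pole
  \<open>\<mu>\<close> of the inversion.
\<close>

lemma winding_number_inversion:
  assumes \<gamma>: "valid_path \<gamma>" "\<mu> \<notin> path_image \<gamma>" and k: "k \<notin> path_image \<gamma>" "k \<noteq> \<mu>"
  shows "winding_number ((\<lambda>z. 1 / (z - \<mu>)) \<circ> \<gamma>) (1 / (k - \<mu>)) =
    winding_number \<gamma> k - winding_number \<gamma> \<mu>"
proof -
  let ?g = "\<lambda>z. 1 / (z - \<mu>)"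
  have notin: "?g k \<notin> path_image (?g \<circ> \<gamma>)"
    using \<gamma>(2) k by (auto simp: path_image_compose)
  have "contour_integral (?g \<circ> \<gamma>) (\<lambda>w. 1 / (w - ?g k)) =
      contour_integral \<gamma> (\<lambda>z. - (1 / (?g z - ?g k)) / (z - \<mu>)\<^sup>2)"
    by (rule contour_integral_inversion[OF \<gamma>])
  also have "\<dots> = contour_integral \<gamma> (\<lambda>z. 1 / (z - k) - 1 / (z - \<mu>))"
  proof (rule contour_integral_cong)
    fix z assume "z \<in> path_image \<gamma>"
    then have z: "z - \<mu> \<noteq> 0" "z - k \<noteq> 0" and k': "k - \<mu> \<noteq> 0" using \<gamma> k by auto
    define A B where "A = z - \<mu>" and "B = k - \<mu>"
    have AB: "A \<noteq> 0" "B \<noteq> 0" "A - B \<noteq> 0" "z - k = A - B" using z k' by (auto simp: A_def B_def)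
    have "1 / A - 1 / B = - ((A - B) / (A * B))"
      using AB by (simp add: field_simps)
    then have "- (1 / (1 / A - 1 / B)) / A\<^sup>2 = B / ((A - B) * A)"
      using AB by (simp add: power2_eq_square)
    then have "- (1 / (?g z - ?g k)) / (z - \<mu>)\<^sup>2 = (k - \<mu>) / ((z - k) * (z - \<mu>))"
      unfolding AB(4) by (simp add: A_def B_def)
    also have "\<dots> = 1 / (z - k) - 1 / (z - \<mu>)" using z by (simp add: diff_frac_eq)
    finally show "- (1 / (?g z - ?g k)) / (z - \<mu>)\<^sup>2 = 1 / (z - k) - 1 / (z - \<mu>)" .
  qed simp
  also have "\<dots> = 2 * pi * \<i> * winding_number \<gamma> k - 2 * pi * \<i> * winding_number \<gamma> \<mu>"
    by (intro contour_integral_unique has_contour_integral_diff has_contour_integral_winding_number \<gamma> k)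
  finally show ?thesis
    by (simp add: winding_number_valid_path[OF valid_path_inversion[OF \<gamma>] notin]
        diff_divide_distrib)
qed

lemma winding_number_inversion_0:
  assumes \<gamma>: "valid_path \<gamma>" "\<mu> \<notin> path_image \<gamma>"
  shows "winding_number ((\<lambda>z. 1 / (z - \<mu>)) \<circ> \<gamma>) 0 = - winding_number \<gamma> \<mu>"
proof -
  let ?g = "\<lambda>z. 1 / (z - \<mu>)"
  have notin: "0 \<notin> path_image (?g \<circ> \<gamma>)" using \<gamma>(2) by (auto simp: path_image_compose)
  have "contour_integral (?g \<circ> \<gamma>) (\<lambda>w. 1 / (w - 0)) =
      contour_integral \<gamma> (\<lambda>z. - (1 / (?g z - 0)) / (z - \<mu>)\<^sup>2)"
    by (rule contour_integral_inversion[OF \<gamma>])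
  also have "\<dots> = contour_integral \<gamma> (\<lambda>z. - (1 / (z - \<mu>)))"
  proof (rule contour_integral_cong)
    fix z assume "z \<in> path_image \<gamma>"
    then have "z - \<mu> \<noteq> 0" using \<gamma> by auto
    then show "- (1 / (?g z - 0)) / (z - \<mu>)\<^sup>2 = - (1 / (z - \<mu>))"
      by (simp add: power2_eq_square divide_simps)
  qed simp
  also have "\<dots> = - (2 * pi * \<i> * winding_number \<gamma> \<mu>)"
    by (intro contour_integral_unique has_contour_integral_neg has_contour_integral_winding_number \<gamma>)
  finally show ?thesis
    using winding_number_valid_path[OF valid_path_inversion[OF \<gamma>] notin] by (simp add: field_simps)
qed

text \<open>
  A curve that winds once about every point of the spectrum may still run between these points, so
  it cannot simply be pushed off to infinity. An inversion about a point \<open>\<mu>\<close> of the spectrum moves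
  the outer domain of the resolvent to a neighbourhood of \<open>0\<close> in which the transformed resolvent
  \<open>w \<mapsto> (1 - w (a - \<mu>))\<^sup>-\<^sup>1\<close> is analytic, and the transformed curve does not wind about any point
  outside that domain. Cauchy's integral formula at \<open>0\<close> then evaluates the integral.
\<close>

lemma contour_integral_resolvent:
  fixes a :: "'a::complex_banach_algebra"
  assumes \<phi>: "bounded_functional \<phi>" and \<gamma>: "valid_path \<gamma>" "pathfinish \<gamma> = pathstart \<gamma>"
    and disj: "path_image \<gamma> \<inter> spectrum a = {}"
    and wind: "\<And>z. z \<in> spectrum a \<Longrightarrow> winding_number \<gamma> z = 1"
  shows "contour_integral \<gamma> (\<lambda>z. \<phi> (resolvent a z)) = 2 * pi * \<i> * \<phi> 1"
proof -
  obtain \<mu> where \<mu>: "\<mu> \<in> spectrum a" using spectrum_nonempty by blast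
  then have \<mu>\<gamma>: "\<mu> \<notin> path_image \<gamma>" using disj by blast
  define b where "b = a - \<mu> *\<^sub>C 1"
  define U where "U = {w. is_invertible (1 + w *\<^sub>C (- b))}"
  define Q where "Q w = ring_inverse (1 + w *\<^sub>C (- b))" for w
  let ?g = "\<lambda>z. 1 / (z - \<mu>)"
  have factor: "z *\<^sub>C 1 - a = (z - \<mu>) *\<^sub>C (1 + ?g z *\<^sub>C (- b))" if "z \<noteq> \<mu>" for z
    using that unfolding scaleC_add_right scaleC_scaleC by (simp add: b_def scaleC_diff_left)
  have gU: "?g z \<in> U" if "z \<notin> spectrum a" for z
    using that \<mu> factor[of z] is_invertible_scaleC[of "z - \<mu>"]
    by (metis U_def mem_Collect_eq not_in_spectrum_iff right_minus_eq)
  have res: "resolvent a z = ?g z *\<^sub>C Q (?g z)" if "z \<notin> spectrum a" for z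
  proof -
    have "z \<noteq> \<mu>" using that \<mu> by auto
    then show ?thesis
      using gU[OF that] unfolding factor[OF \<open>z \<noteq> \<mu>\<close>] Q_def U_def
      by (intro ring_inverse_eqI) (simp_all add: mult_scaleC_left mult_scaleC_right scaleC_scaleC)
  qed
  have loop: "pathfinish (?g \<circ> \<gamma>) = pathstart (?g \<circ> \<gamma>)"
    using \<gamma>(2) by (simp add: pathfinish_def pathstart_def)
  have "((\<lambda>w. \<phi> (Q w) / (w - 0)) has_contour_integral
      2 * pi * \<i> * winding_number (?g \<circ> \<gamma>) 0 * \<phi> (Q 0)) (?g \<circ> \<gamma>)"
  proof (rule Cauchy_integral_formula_global[where S = U])
    show "open U" unfolding U_def by (rule open_affine_invertible)
    show "(\<lambda>w. \<phi> (Q w)) holomorphic_on U"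
      unfolding Q_def by (rule holomorphic_affine_inverse[OF \<phi>]) (simp add: U_def)
    show "0 \<in> U" by (simp add: U_def)
    show "valid_path (?g \<circ> \<gamma>)" by (rule valid_path_inversion[OF \<gamma>(1) \<mu>\<gamma>])
    show "path_image (?g \<circ> \<gamma>) \<subseteq> U - {0}"
      using gU disj \<mu>\<gamma> by (auto simp: path_image_compose)
    show "pathfinish (?g \<circ> \<gamma>) = pathstart (?g \<circ> \<gamma>)" by (rule loop)
    fix w assume w: "w \<notin> U"
    define k where "k = \<mu> + 1 / w"
    have "w \<noteq> 0" using w by (auto simp: U_def)
    then have k: "k \<noteq> \<mu>" "w = ?g k" by (auto simp: k_def)
    have "k \<in> spectrum a" using gU[of k] w k by auto
    then show "winding_number (?g \<circ> \<gamma>) w = 0"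
      unfolding k(2) using winding_number_inversion[OF \<gamma>(1) \<mu>\<gamma> _ k(1)] wind \<mu> disj by auto
  qed
  then have "contour_integral (?g \<circ> \<gamma>) (\<lambda>w. \<phi> (Q w) / w) = - (2 * pi * \<i> * \<phi> 1)"
    using winding_number_inversion_0[OF \<gamma>(1) \<mu>\<gamma>] wind[OF \<mu>]
    by (simp add: contour_integral_unique Q_def)
  moreover have "contour_integral (?g \<circ> \<gamma>) (\<lambda>w. \<phi> (Q w) / w) =
      contour_integral \<gamma> (\<lambda>z. - \<phi> (resolvent a z))"
    unfolding contour_integral_inversion[OF \<gamma>(1) \<mu>\<gamma>]
  proof (rule contour_integral_cong)
    fix z assume "z \<in> path_image \<gamma>"
    then have "z \<notin> spectrum a" "z \<noteq> \<mu>" using disj \<mu>\<gamma> by auto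
    then show "- (\<phi> (Q (?g z)) / ?g z) / (z - \<mu>)\<^sup>2 = - \<phi> (resolvent a z)"
      by (simp add: res bounded_functional_linear(4)[OF \<phi>] power2_eq_square)
  qed simp
  moreover have "contour_integral \<gamma> (\<lambda>z. - \<phi> (resolvent a z)) =
      - contour_integral \<gamma> (\<lambda>z. \<phi> (resolvent a z))"
    by (rule contour_integral_neg)
  ultimately show ?thesis by simp
qed

section \<open>Real powers as binomial series\<close>

lemma summable_gbinomial_abs:
  fixes \<alpha> :: real
  assumes "0 \<le> r" "r < 1"
  shows "summable (\<lambda>n. \<bar>\<alpha> gchoose n\<bar> * r ^ n)"
proof -
  obtain r' where r': "r < r'" "r' < 1" using dense[OF assms(2)] by blast
  have "summable (\<lambda>n. (\<alpha> gchoose n) * r' ^ n)"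
    using gen_binomial_real[of r' \<alpha>] r' assms(1) by (intro sums_summable) auto
  then have "summable (\<lambda>n. norm ((\<alpha> gchoose n) * r ^ n))"
    by (rule powser_insidea) (use r' assms(1) in auto)
  then show ?thesis using assms(1) by (simp add: abs_mult)
qed

lemma summable_norm_power_series:
  fixes u :: "'a::{real_normed_algebra,ring_1,real_algebra_1}" and c :: "nat \<Rightarrow> real"
  assumes u: "powers_dominated u s" "s < 1"
    and c: "\<And>r. 0 \<le> r \<Longrightarrow> r < 1 \<Longrightarrow> summable (\<lambda>n. \<bar>c n\<bar> * r ^ n)"
  shows "summable (\<lambda>n. norm (c n *\<^sub>R u ^ n))"
proof -
  obtain M where M: "\<And>n. norm (u ^ n) \<le> M * s ^ n" using u powers_dominatedE by metis
  have s: "s \<ge> 0" using u by (simp add: powers_dominated_def)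
  show ?thesis
  proof (rule summable_comparison_test')
    show "summable (\<lambda>n. M * (\<bar>c n\<bar> * s ^ n))" by (intro summable_mult c s u)
    show "norm (norm (c n *\<^sub>R u ^ n)) \<le> M * (\<bar>c n\<bar> * s ^ n)" if "n \<ge> 0" for n
      using mult_left_mono[OF M[of n], of "\<bar>c n\<bar>"] by (simp add: mult_ac)
  qed
qed

definition binomial_series :: "real \<Rightarrow> 'a::{real_normed_algebra,real_algebra_1} \<Rightarrow> 'a" where
  "binomial_series \<alpha> u = (\<Sum>n. (\<alpha> gchoose n) *\<^sub>R u ^ n)"

lemma binomial_series_sums:
  fixes u :: "'a::complex_banach_algebra"
  assumes "powers_dominated u s" "s < 1"
  shows "summable (\<lambda>n. norm ((\<alpha> gchoose n) *\<^sub>R u ^ n))"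
    and "(\<lambda>n. (\<alpha> gchoose n) *\<^sub>R u ^ n) sums binomial_series \<alpha> u"
proof -
  show "summable (\<lambda>n. norm ((\<alpha> gchoose n) *\<^sub>R u ^ n))"
    using summable_norm_power_series[OF assms] summable_gbinomial_abs by blast
  then show "(\<lambda>n. (\<alpha> gchoose n) *\<^sub>R u ^ n) sums binomial_series \<alpha> u"
    by (simp add: binomial_series_def summable_norm_cancel summable_sums)
qed

text \<open>The law of exponents is the Vandermonde convolution of the coefficients.\<close>

lemma binomial_series_add:
  fixes u :: "'a::complex_banach_algebra"
  assumes "powers_dominated u s" "s < 1"
  shows "binomial_series \<alpha> u * binomial_series \<beta> u = binomial_series (\<alpha> + \<beta>) u"
proof -
  have "binomial_series \<alpha> u * binomial_series \<beta> u =
      (\<Sum>n. \<Sum>i\<le>n. ((\<alpha> gchoose i) *\<^sub>R u ^ i) * ((\<beta> gchoose (n - i)) *\<^sub>R u ^ (n - i)))"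
    unfolding binomial_series_def by (intro Cauchy_product binomial_series_sums[OF assms])
  also have "\<dots> = (\<Sum>n. ((\<alpha> + \<beta>) gchoose n) *\<^sub>R u ^ n)"
  proof (rule suminf_cong)
    fix n
    have "(\<Sum>i\<le>n. ((\<alpha> gchoose i) *\<^sub>R u ^ i) * ((\<beta> gchoose (n - i)) *\<^sub>R u ^ (n - i))) =
        (\<Sum>i\<le>n. (\<alpha> gchoose i) * (\<beta> gchoose (n - i))) *\<^sub>R u ^ n"
      unfolding scaleR_sum_left by (intro sum.cong) (simp_all flip: power_add)
    then show "(\<Sum>i\<le>n. ((\<alpha> gchoose i) *\<^sub>R u ^ i) * ((\<beta> gchoose (n - i)) *\<^sub>R u ^ (n - i))) =
        ((\<alpha> + \<beta>) gchoose n) *\<^sub>R u ^ n"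
      by (simp add: gbinomial_Vandermonde atMost_atLeast0)
  qed
  finally show ?thesis by (simp add: binomial_series_def)
qed

lemma binomial_series_0 [simp]: "binomial_series 0 u = 1"
proof -
  have "(0::real) gchoose n = 0" if "n \<noteq> 0" for n using that by (cases n) auto
  then have "binomial_series 0 u = (\<Sum>n\<in>{0}. ((0::real) gchoose n) *\<^sub>R u ^ n)"
    unfolding binomial_series_def by (intro suminf_finite) auto
  then show ?thesis by simp
qed

lemma binomial_series_1 [simp]: "binomial_series 1 u = 1 + u"
proof -
  have "(1::real) gchoose n = 0" if "n \<notin> {0, 1}" for n
  proof -
    have "1 choose n = 0" using that by (intro binomial_eq_0) auto
    moreover have "(1::real) gchoose n = of_nat (1 choose n)" by (metis binomial_gbinomial of_nat_1)
    ultimately show ?thesis by (simp only: of_nat_0)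
  qed
  then have "binomial_series 1 u = (\<Sum>n\<in>{0, 1}. ((1::real) gchoose n) *\<^sub>R u ^ n)"
    unfolding binomial_series_def by (intro suminf_finite) auto
  then show ?thesis by simp
qed

text \<open>
  The divided difference \<open>(\<zeta>\<^sup>m - u\<^sup>m) / (\<zeta> - u)\<close> with \<open>m = Suc n\<close>, expanded so that it is
  defined for all \<open>\<zeta>\<close>.
\<close>

definition power_divdiff :: "'a::complex_banach_algebra \<Rightarrow> nat \<Rightarrow> complex \<Rightarrow> 'a" where
  "power_divdiff u n \<zeta> = (\<Sum>k\<le>n. \<zeta> ^ k *\<^sub>C u ^ (n - k))"

lemma power_divdiff_mult:
  "(\<zeta> *\<^sub>C 1 - u) * power_divdiff u n \<zeta> = \<zeta> ^ Suc n *\<^sub>C 1 - u ^ Suc n"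
proof (induction n)
  case 0
  then show ?case by (simp add: power_divdiff_def)
next
  case (Suc n)
  have "power_divdiff u (Suc n) \<zeta> = power_divdiff u n \<zeta> * u + \<zeta> ^ Suc n *\<^sub>C 1"
    unfolding power_divdiff_def
    by (simp add: sum_distrib_right mult_scaleC_left Suc_diff_le flip: power_Suc2)
  then have "(\<zeta> *\<^sub>C 1 - u) * power_divdiff u (Suc n) \<zeta> =
      (\<zeta> ^ Suc n *\<^sub>C 1 - u ^ Suc n) * u + \<zeta> ^ Suc n *\<^sub>C (\<zeta> *\<^sub>C 1 - u)"
    by (simp only: distrib_left Suc.IH mult_scaleC_right mult_1_right flip: mult.assoc)
  also have "\<dots> = \<zeta> ^ Suc (Suc n) *\<^sub>C 1 - u ^ Suc (Suc n)"
    by (simp only: left_diff_distrib mult_scaleC_left scaleC_diff_right scaleC_scaleC mult_1_left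
        power_Suc2[symmetric]) simp
  finally show ?case .
qed

lemma norm_power_divdiff_le:
  assumes M: "\<And>n. norm (u ^ n) \<le> M * r ^ n" and r: "cmod \<zeta> \<le> r"
  shows "norm (power_divdiff u n \<zeta>) \<le> M * (real (Suc n) * r ^ n)"
proof -
  have r0: "r \<ge> 0" using r norm_ge_zero order_trans by blast
  have "norm (power_divdiff u n \<zeta>) \<le> (\<Sum>k\<le>n. M * r ^ n)"
    unfolding power_divdiff_def
  proof (rule sum_norm_le)
    fix k assume "k \<in> {..n}"
    have "norm (\<zeta> ^ k *\<^sub>C u ^ (n - k)) = cmod \<zeta> ^ k * norm (u ^ (n - k))"
      by (simp add: norm_scaleC norm_power)
    also have "\<dots> \<le> r ^ k * (M * r ^ (n - k))"
      using r r0 by (intro mult_mono power_mono M) auto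
    also have "\<dots> = M * r ^ n" using \<open>k \<in> {..n}\<close> by (simp flip: power_add)
    finally show "norm (\<zeta> ^ k *\<^sub>C u ^ (n - k)) \<le> M * r ^ n" .
  qed
  then show ?thesis by (simp add: mult_ac)
qed

lemma holomorphic_power_divdiff:
  assumes "bounded_functional \<phi>"
  shows "(\<lambda>\<zeta>. \<phi> (power_divdiff u n \<zeta>)) holomorphic_on S"
proof -
  have "\<phi> (power_divdiff u n \<zeta>) = (\<Sum>k\<le>n. \<zeta> ^ k * \<phi> (u ^ (n - k)))" for \<zeta>
    using bounded_functional_linear[OF assms]
    by (simp add: power_divdiff_def linear_sum[OF bounded_linear.linear])
  then show ?thesis by (auto intro!: holomorphic_intros)
qed

text \<open>
  For a power series \<open>f\<close> that converges on the unit disc and an element \<open>u\<close> with spectral radius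
  below \<open>1\<close>, the divided difference \<open>h \<zeta>\<close> in \<open>f \<zeta> - f u = (\<zeta> - u) * h \<zeta>\<close> is analytic on the whole
  disc, also at the points of the spectrum.
\<close>

lemma power_series_divdiff:
  fixes u :: "'a::complex_banach_algebra" and c :: "nat \<Rightarrow> real"
  assumes u: "powers_dominated u s" "s < 1"
    and c: "\<And>r. 0 \<le> r \<Longrightarrow> r < 1 \<Longrightarrow> summable (\<lambda>n. \<bar>c n\<bar> * r ^ n)"
    and f: "\<And>\<zeta>. cmod \<zeta> < 1 \<Longrightarrow> (\<lambda>n. of_real (c n) * \<zeta> ^ n) sums f \<zeta>"
  obtains h where
    "\<And>\<zeta>. cmod \<zeta> < 1 \<Longrightarrow> (\<zeta> *\<^sub>C 1 - u) * h \<zeta> = f \<zeta> *\<^sub>C 1 - (\<Sum>n. c n *\<^sub>R u ^ n)"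
    "\<And>\<phi>. bounded_functional \<phi> \<Longrightarrow> (\<lambda>\<zeta>. \<phi> (h \<zeta>)) holomorphic_on ball 0 1"
proof
  let ?t = "\<lambda>n \<zeta>. c (Suc n) *\<^sub>R power_divdiff u n \<zeta>"
  define h where "h \<zeta> = (\<Sum>n. ?t n \<zeta>)" for \<zeta>
  have s0: "s \<ge> 0" using u by (simp add: powers_dominated_def)
  obtain M where M: "M > 0" "\<And>n. norm (u ^ n) \<le> M * s ^ n" using u powers_dominatedE by metis
  let ?b = "\<lambda>r n. M * (\<bar>c (Suc n)\<bar> * (real (Suc n) * r ^ n))"
  have bound: "norm (?t n \<zeta>) \<le> ?b r n" if "cmod \<zeta> \<le> r" "s \<le> r" for \<zeta> r n
  proof -
    have "norm (u ^ m) \<le> M * r ^ m" for m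
    proof -
      have "M * s ^ m \<le> M * r ^ m" using M(1) that(2) s0 by (intro mult_left_mono power_mono) auto
      with M(2)[of m] show ?thesis by simp
    qed
    then have "norm (power_divdiff u n \<zeta>) \<le> M * (real (Suc n) * r ^ n)"
      using that(1) by (intro norm_power_divdiff_le)
    then have "\<bar>c (Suc n)\<bar> * norm (power_divdiff u n \<zeta>) \<le> \<bar>c (Suc n)\<bar> * (M * (real (Suc n) * r ^ n))"
      by (intro mult_left_mono) auto
    then show ?thesis by (simp add: mult_ac)
  qed
  have summ: "summable (?b r)" if "0 \<le> r" "r < 1" for r
  proof -
    have "summable (\<lambda>n. diffs (\<lambda>n. \<bar>c n\<bar>) n * r ^ n)"
    proof (rule termdiff_converges)
      show "norm r < 1" using that by simp
      show "summable (\<lambda>n. \<bar>c n\<bar> * x ^ n)" if "norm x < 1" for x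
        using c[of "\<bar>x\<bar>"] that
        by (intro summable_norm_cancel[of "\<lambda>n. \<bar>c n\<bar> * x ^ n"]) (simp add: abs_mult power_abs)
    qed
    then show ?thesis by (intro summable_mult) (simp add: diffs_def mult_ac)
  qed
  have h: "(\<lambda>n. ?t n \<zeta>) sums h \<zeta>" if "cmod \<zeta> < 1" for \<zeta>
    unfolding h_def
  proof (rule summable_sums, rule summable_comparison_test'[where N = 0])
    show "summable (?b (max (cmod \<zeta>) s))" using that u(2) s0 by (intro summ) auto
    show "norm (?t n \<zeta>) \<le> ?b (max (cmod \<zeta>) s) n" for n by (rule bound) auto
  qed
  show "(\<zeta> *\<^sub>C 1 - u) * h \<zeta> = f \<zeta> *\<^sub>C 1 - (\<Sum>n. c n *\<^sub>R u ^ n)" if \<zeta>: "cmod \<zeta> < 1" for \<zeta>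
  proof (rule sums_unique2)
    let ?d = "\<lambda>n. c n *\<^sub>R (\<zeta> ^ n *\<^sub>C 1 - u ^ n)"
    have "(\<lambda>n. (\<zeta> *\<^sub>C 1 - u) * ?t n \<zeta>) sums ((\<zeta> *\<^sub>C 1 - u) * h \<zeta>)"
      by (rule bounded_linear.sums[OF bounded_linear_mult_right h[OF \<zeta>]])
    then have "(\<lambda>n. ?d (Suc n)) sums ((\<zeta> *\<^sub>C 1 - u) * h \<zeta>)"
      by (simp only: mult_scaleR_right power_divdiff_mult)
    then have "?d sums ((\<zeta> *\<^sub>C 1 - u) * h \<zeta> + ?d 0)"
      by (rule iffD1[OF sums_Suc_iff])
    then show "?d sums ((\<zeta> *\<^sub>C 1 - u) * h \<zeta>)" by simp
    have "(\<lambda>n. c n *\<^sub>R u ^ n) sums (\<Sum>n. c n *\<^sub>R u ^ n)"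
      by (rule summable_sums[OF summable_norm_cancel[OF summable_norm_power_series[OF u c]]])
    moreover have "(\<lambda>n. (of_real (c n) * \<zeta> ^ n) *\<^sub>C (1::'a)) sums (f \<zeta> *\<^sub>C 1)"
      by (rule bounded_linear.sums[OF bounded_bilinear.bounded_linear_left[OF bounded_bilinear_scaleC] f[OF \<zeta>]])
    ultimately have "(\<lambda>n. (of_real (c n) * \<zeta> ^ n) *\<^sub>C (1::'a) - c n *\<^sub>R u ^ n) sums
        (f \<zeta> *\<^sub>C 1 - (\<Sum>n. c n *\<^sub>R u ^ n))" by (intro sums_diff)
    then show "?d sums (f \<zeta> *\<^sub>C 1 - (\<Sum>n. c n *\<^sub>R u ^ n))"
      by (simp add: scaleR_diff_right scaleR_scaleC)
  qed
  show "(\<lambda>\<zeta>. \<phi> (h \<zeta>)) holomorphic_on ball 0 1" if \<phi>: "bounded_functional \<phi>" for \<phi>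
  proof (rule holomorphic_uniform_sequence[where f = "\<lambda>N \<zeta>. \<Sum>n<N. \<phi> (?t n \<zeta>)"])
    note lin = bounded_functional_linear[OF \<phi>]
    show "(\<lambda>\<zeta>. \<Sum>n<N. \<phi> (?t n \<zeta>)) holomorphic_on ball 0 1" for N
      by (simp add: lin(5)) (intro holomorphic_intros holomorphic_power_divdiff \<phi>)
    obtain K where K: "K > 0" "\<And>x. cmod (\<phi> x) \<le> norm x * K"
      using bounded_linear.pos_bounded[OF lin(1)] by blast
    fix x :: complex assume x: "x \<in> ball 0 1"
    define d where "d = (1 - cmod x) / 2"
    define r where "r = max (cmod x + d) s"
    have r: "r < 1" "s \<le> r" "0 \<le> r" "d > 0" using x u(2) s0 by (auto simp: d_def r_def field_simps)
    have r': "cmod \<zeta> \<le> r" if "\<zeta> \<in> cball x d" for \<zeta>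
      using that norm_triangle_ineq[of x "\<zeta> - x"] by (auto simp: r_def dist_norm norm_minus_commute)
    show "\<exists>d>0. cball x d \<subseteq> ball 0 1 \<and>
        uniform_limit (cball x d) (\<lambda>N \<zeta>. \<Sum>n<N. \<phi> (?t n \<zeta>)) (\<lambda>\<zeta>. \<phi> (h \<zeta>)) sequentially"
    proof (intro exI conjI)
      show "d > 0" "cball x d \<subseteq> ball 0 1" using r r' by (auto simp: subset_iff intro: le_less_trans)
      have "uniform_limit (cball x d) (\<lambda>N \<zeta>. \<Sum>n<N. \<phi> (?t n \<zeta>)) (\<lambda>\<zeta>. \<Sum>n. \<phi> (?t n \<zeta>)) sequentially"
      proof (rule Weierstrass_m_test)
        show "summable (\<lambda>n. ?b r n * K)" by (intro summable_mult2 summ r)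
        show "cmod (\<phi> (?t n \<zeta>)) \<le> ?b r n * K" if "\<zeta> \<in> cball x d" for n \<zeta>
          by (rule order_trans[OF K(2)]) (intro mult_right_mono bound r' that r less_imp_le[OF K(1)])
      qed
      moreover have "(\<Sum>n. \<phi> (?t n \<zeta>)) = \<phi> (h \<zeta>)" if "\<zeta> \<in> cball x d" for \<zeta>
        using bounded_linear.sums[OF lin(1) h[of \<zeta>]] r'[OF that] r(1) by (simp add: sums_iff)
      ultimately show "uniform_limit (cball x d) (\<lambda>N \<zeta>. \<Sum>n<N. \<phi> (?t n \<zeta>)) (\<lambda>\<zeta>. \<phi> (h \<zeta>)) sequentially"
        by (subst uniform_limit_cong'[symmetric]) (auto intro: refl)
    qed
  qed simp
qed

definition positive_spectrum :: "'a::complex_banach_algebra \<Rightarrow> bool" where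
  "positive_spectrum a \<longleftrightarrow> spectrum a \<subseteq> complex_of_real ` {0<..}"

lemma positive_spectrumD:
  "positive_spectrum a \<Longrightarrow> z \<in> spectrum a \<Longrightarrow> \<exists>r>0. z = of_real r"
  by (auto simp: positive_spectrum_def)

text \<open>
  The map \<open>z \<mapsto> z / C - 1\<close> sends the spectrum, which lies between \<open>0\<close> and \<open>norm a\<close>, into the open
  unit disc; by the spectral radius formula the rescaled element then has a ratio below \<open>1\<close>.
\<close>

lemma rescaled_powers_dominated:
  fixes a :: "'a::complex_banach_algebra"
  assumes a: "positive_spectrum a" and C: "C > norm a"
  obtains s where "0 < s" "s < 1" "powers_dominated ((1 / C) *\<^sub>R a - 1) s"
proof (rule powers_dominated_of_spectrum)
  have C0: "C > 0" using C norm_ge_zero[of a] by linarith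
  show "spectrum ((1 / C) *\<^sub>R a - 1) \<subseteq> ball 0 1"
  proof
    fix z assume z: "z \<in> spectrum ((1 / C) *\<^sub>R a - 1)"
    have "(of_real C * (z + 1)) *\<^sub>C 1 - a = of_real C *\<^sub>C (z *\<^sub>C 1 - ((1 / C) *\<^sub>R a - 1))"
      using C0 by (simp add: scaleC_algebra_simps scaleC_scaleC scaleC_of_real distrib_left)
    then have "of_real C * (z + 1) \<in> spectrum a"
      using z C0 by (simp add: spectrum_def is_invertible_scaleC)
    moreover obtain \<rho> where \<rho>: "\<rho> > 0" "of_real C * (z + 1) = complex_of_real \<rho>"
      using positive_spectrumD[OF a calculation] by auto
    ultimately have "\<rho> \<le> norm a" using spectrum_bounded[of a] by auto
    have "z = of_real (\<rho> / C - 1)" using \<rho>(2) C0 by (simp add: field_simps)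
    then have "cmod z = \<bar>\<rho> / C - 1\<bar>" by (simp only: norm_of_real)
    also have "\<dots> < 1" using \<rho>(1) \<open>\<rho> \<le> norm a\<close> C C0 by (simp add: abs_less_iff field_simps)
    finally show "z \<in> ball 0 1" by simp
  qed
qed simp_all

lemma ex_encloses_spectrum:
  fixes a :: "'a::complex_banach_algebra"
  assumes a: "positive_spectrum a"
  obtains \<gamma> where "encloses_spectrum \<gamma> a"
proof -
  define C where "C = norm a + 1"
  have C: "C > norm a" "C > 0" by (auto simp: C_def add_nonneg_pos)
  obtain s where s: "0 < s" "s < 1" "powers_dominated ((1 / C) *\<^sub>R a - 1) s"
    using rescaled_powers_dominated[OF a C(1)] by blast
  have near: "cmod (z - of_real C) \<le> C * s" if "z \<in> spectrum a" for z
  proof -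
    have "(z / of_real C - 1) *\<^sub>C 1 - ((1 / C) *\<^sub>R a - 1) = (1 / of_real C) *\<^sub>C (z *\<^sub>C 1 - a)"
      using C by (simp add: scaleC_algebra_simps scaleC_scaleC flip: scaleC_of_real)
    then have "z / of_real C - 1 \<in> spectrum ((1 / C) *\<^sub>R a - 1)"
      using that C by (simp add: spectrum_def is_invertible_scaleC)
    then have "cmod (z / of_real C - 1) \<le> s" using spectrum_subset_cball[OF s(3)] by auto
    moreover have "z - of_real C = of_real C * (z / of_real C - 1)"
      using C by (simp add: field_simps)
    then have "cmod (z - of_real C) = C * cmod (z / of_real C - 1)"
      using C by (metis abs_of_pos norm_mult norm_of_real)
    ultimately show ?thesis using C by simp
  qed
  define r where "r = C * ((s + 1) / 2)"
  have r: "C * s < r" "r < C" "0 < r" using C s by (auto simp: r_def)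
  have "encloses_spectrum (circlepath (of_real C) r) a"
    unfolding encloses_spectrum_def
  proof (intro conjI ballI)
    show "path_image (circlepath (of_real C) r) \<subseteq> {z. Re z > 0} - spectrum a"
    proof
      fix z assume "z \<in> path_image (circlepath (of_real C) r)"
      then have z: "cmod (z - of_real C) = r" using r by (simp add: dist_norm norm_minus_commute)
      then have "z \<notin> spectrum a" using near[of z] r by auto
      moreover have "\<bar>Re (z - of_real C)\<bar> \<le> r" using abs_Re_le_cmod z by metis
      then have "Re z > 0" using r by simp
      ultimately show "z \<in> {z. Re z > 0} - spectrum a" by simp
    qed
    show "winding_number (circlepath (of_real C) r) z = 1" if "z \<in> spectrum a" for z
      using near[OF that] r by (intro winding_number_circlepath) simp
  qed auto
  then show ?thesis using that by blast
qed

text \<open>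
  The discs about \<open>C\<close> with radius \<open>C\<close> exhaust the right half-plane: \<open>z\<close> lies in such a disc if and
  only if \<open>(cmod z)\<^sup>2 < 2 * C * Re z\<close>. On these discs the power function is a binomial series.
\<close>

lemma compact_right_half_plane_subset_ball:
  assumes "compact K" "K \<subseteq> {z. Re z > 0}"
  obtains C0 where "\<And>C. C \<ge> C0 \<Longrightarrow> C > 0 \<Longrightarrow> K \<subseteq> ball (complex_of_real C) C"
proof -
  have "continuous_on K (\<lambda>z. (cmod z)\<^sup>2 / Re z)"
    using assms(2) by (intro continuous_intros) auto
  then have "bounded ((\<lambda>z. (cmod z)\<^sup>2 / Re z) ` K)"
    by (intro compact_imp_bounded compact_continuous_image assms(1))
  then obtain B where B: "\<And>z. z \<in> K \<Longrightarrow> \<bar>(cmod z)\<^sup>2 / Re z\<bar> \<le> B"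
    unfolding bounded_iff by auto
  have "K \<subseteq> ball (complex_of_real C) C" if C: "C \<ge> B" "C > 0" for C
  proof
    fix z assume z: "z \<in> K"
    then have Re: "Re z > 0" using assms(2) by auto
    have "(cmod z)\<^sup>2 / Re z \<le> B" using B[OF z] Re by simp
    also have "\<dots> < 2 * C" using C by simp
    finally have "(cmod z)\<^sup>2 < 2 * C * Re z" using Re by (simp add: field_simps)
    then have "(cmod (of_real C - z))\<^sup>2 < C\<^sup>2"
      by (simp add: cmod_power2 power2_diff)
    then have "cmod (of_real C - z) < C" using C by (simp add: power2_less_imp_less)
    then show "z \<in> ball (of_real C) C" by (simp add: dist_norm)
  qed
  then show ?thesis using that by blast
qed

lemma powr_complex_binomial:
  assumes C: "C > 0" and z: "z \<in> ball (complex_of_real C) C"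
  shows "z powr of_real \<alpha> = of_real (C powr \<alpha>) * (1 + (z / of_real C - 1)) powr of_real \<alpha>"
proof -
  have "z powr of_real \<alpha> = (of_real C * (z / of_real C)) powr of_real \<alpha>" using C by simp
  also have "\<dots> = of_real C powr of_real \<alpha> * (z / of_real C) powr of_real \<alpha>"
    using C by (intro powr_times_real_left) auto
  finally show ?thesis using C by (simp add: powr_of_real)
qed

text \<open>
  The Cauchy integral of the power function, along any admissible curve, is the binomial series:
  the divided difference integrates to zero and what remains is the integral of the resolvent.
\<close>

lemma contour_integral_power_resolvent:
  fixes a :: "'a::complex_banach_algebra"
  assumes \<phi>: "bounded_functional \<phi>" and \<gamma>: "encloses_spectrum \<gamma> a"
    and C: "C > 0" "path_image \<gamma> \<subseteq> ball (of_real C) C"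
    and u: "powers_dominated ((1 / C) *\<^sub>R a - 1) s" "s < 1"
  shows "((\<lambda>z. z powr of_real \<alpha> * \<phi> (resolvent a z)) has_contour_integral
    2 * pi * \<i> * \<phi> ((C powr \<alpha>) *\<^sub>R binomial_series \<alpha> ((1 / C) *\<^sub>R a - 1))) \<gamma>"
proof -
  define u where "u = (1 / C) *\<^sub>R a - 1"
  define T where "T = (C powr \<alpha>) *\<^sub>R binomial_series \<alpha> u"
  define f where "f \<zeta> = (1 + \<zeta>) powr complex_of_real \<alpha>" for \<zeta>
  define \<zeta> where "\<zeta> z = z / of_real C - 1" for z :: complex
  have \<gamma>': "valid_path \<gamma>" "pathfinish \<gamma> = pathstart \<gamma>" "path_image \<gamma> \<inter> spectrum a = {}"
      "\<And>z. z \<in> spectrum a \<Longrightarrow> winding_number \<gamma> z = 1"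
    using \<gamma> by (auto simp: encloses_spectrum_def)
  have gb: "complex_of_real \<alpha> gchoose n = of_real (\<alpha> gchoose n)" for n
    by (simp add: gbinomial_prod_rev of_real_prod)
  have f: "(\<lambda>n. of_real (\<alpha> gchoose n) * z ^ n) sums f z" if "cmod z < 1" for z
    using gen_binomial_complex[OF that, of "of_real \<alpha>"] by (simp add: f_def gb)
  obtain h where h: "\<And>z. cmod z < 1 \<Longrightarrow> (z *\<^sub>C 1 - u) * h z = f z *\<^sub>C 1 - binomial_series \<alpha> u"
      and hol: "\<And>\<phi>. bounded_functional \<phi> \<Longrightarrow> (\<lambda>z. \<phi> (h z)) holomorphic_on ball 0 1"
    using power_series_divdiff[OF u[folded u_def] summable_gbinomial_abs f] unfolding binomial_series_def by metis
  have \<zeta>1: "cmod (\<zeta> z) < 1" if "z \<in> ball (of_real C) C" for z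
  proof -
    have "z - of_real C = of_real C * \<zeta> z" using C(1) by (simp add: \<zeta>_def field_simps)
    then have "cmod (z - of_real C) = C * cmod (\<zeta> z)"
      using C(1) by (metis abs_of_pos norm_mult norm_of_real)
    moreover have "cmod (z - of_real C) < C" using that by (simp add: dist_norm norm_minus_commute)
    ultimately show ?thesis using C(1) by simp
  qed
  note lin = bounded_functional_linear[OF \<phi>]
  have "(\<lambda>z. of_real (C powr \<alpha> / C) * \<phi> (h (\<zeta> z))) holomorphic_on ball (of_real C) C"
  proof (intro holomorphic_intros)
    have "(\<lambda>z. \<phi> (h z)) \<circ> \<zeta> holomorphic_on ball (of_real C) C"
    proof (rule holomorphic_on_compose_gen[OF _ hol[OF \<phi>]])
      show "\<zeta> holomorphic_on ball (of_real C) C"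
        unfolding \<zeta>_def using C(1) by (intro holomorphic_intros) auto
      show "\<zeta> ` ball (of_real C) C \<subseteq> ball 0 1" using \<zeta>1 by auto
    qed
    then show "(\<lambda>z. \<phi> (h (\<zeta> z))) holomorphic_on ball (of_real C) C" by (simp add: o_def)
  qed
  then have int_h: "((\<lambda>z. of_real (C powr \<alpha> / C) * \<phi> (h (\<zeta> z))) has_contour_integral 0) \<gamma>"
    using C(2) \<gamma>'(1,2) by (intro Cauchy_theorem_convex_simple[where S = "ball (of_real C) C"]) auto
  \<comment> \<open>The term \<open>resolvent a z * T\<close> with \<open>T\<close> the power of \<open>a\<close>: multiplication by \<open>T\<close> is absorbed
    into the functional.\<close>
  define \<psi> where "\<psi> x = \<phi> (x * T)" for x
  have \<psi>: "bounded_functional \<psi>"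
    unfolding bounded_functional_def \<psi>_def
    by (intro conjI allI bounded_linear_compose[OF lin(1) bounded_linear_mult_left])
       (simp add: mult_scaleC_left lin)
  have "(\<lambda>z. \<psi> (resolvent a z)) contour_integrable_on \<gamma>"
    using \<gamma>'(3) by (intro contour_integrable_holomorphic_simple[OF
        holomorphic_on_resolvent[OF \<psi>, of "- spectrum a" a] open_resolvent_set \<gamma>'(1)]) auto
  then have "((\<lambda>z. \<psi> (resolvent a z)) has_contour_integral 2 * pi * \<i> * \<psi> 1) \<gamma>"
    using contour_integral_resolvent[OF \<psi> \<gamma>'] has_contour_integral_integral by fastforce
  from has_contour_integral_add[OF this int_h]
  have "((\<lambda>z. \<psi> (resolvent a z) + of_real (C powr \<alpha> / C) * \<phi> (h (\<zeta> z))) has_contour_integral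
      2 * pi * \<i> * \<phi> T) \<gamma>"
    by (simp add: \<psi>_def)
  then show ?thesis
    unfolding T_def[symmetric] u_def[symmetric]
  proof (rule has_contour_integral_eq)
    fix z assume z: "z \<in> path_image \<gamma>"
    then have zb: "z \<in> ball (of_real C) C" and inv: "is_invertible (z *\<^sub>C 1 - a)"
      using C(2) \<gamma>'(3) by (auto simp: spectrum_def)
    have fz: "of_real (C powr \<alpha>) * f (\<zeta> z) = z powr of_real \<alpha>"
      using powr_complex_binomial[OF C(1) zb] by (simp add: f_def \<zeta>_def)
    have "of_real C *\<^sub>C (\<zeta> z *\<^sub>C 1 - u) = z *\<^sub>C 1 - a"
      using C(1) by (simp add: \<zeta>_def u_def scaleC_algebra_simps scaleC_scaleC scaleC_of_real)
    then have "(z *\<^sub>C 1 - a) * (of_real (C powr \<alpha> / C) *\<^sub>C h (\<zeta> z)) =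
        of_real (C powr \<alpha>) *\<^sub>C ((\<zeta> z *\<^sub>C 1 - u) * h (\<zeta> z))"
      using C(1) by (simp add: mult_scaleC_left mult_scaleC_right scaleC_scaleC flip: \<open>_ = z *\<^sub>C 1 - a\<close>)
    also have "\<dots> = (z powr of_real \<alpha>) *\<^sub>C 1 - T"
      by (simp add: h[OF \<zeta>1[OF zb]] scaleC_diff_right scaleC_scaleC fz T_def scaleC_of_real)
    finally have "of_real (C powr \<alpha> / C) *\<^sub>C h (\<zeta> z) = resolvent a z * ((z powr of_real \<alpha>) *\<^sub>C 1 - T)"
      using inv by (metis ring_inverse_left_assoc)
    also have "\<dots> = (z powr of_real \<alpha>) *\<^sub>C resolvent a z - resolvent a z * T"
      by (simp add: right_diff_distrib mult_scaleC_right)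
    finally show "\<psi> (resolvent a z) + of_real (C powr \<alpha> / C) * \<phi> (h (\<zeta> z)) =
        z powr of_real \<alpha> * \<phi> (resolvent a z)"
      by (metis \<psi>_def add.commute diff_add_cancel lin(2,4))
  qed
qed

lemma alg_contour_integrable_power_resolvent:
  fixes a :: "'a::complex_banach_algebra"
  assumes "encloses_spectrum \<gamma> a"
  shows "alg_contour_integrable \<gamma> (\<lambda>z. (z powr complex_of_real \<alpha>) *\<^sub>C resolvent a z)"
proof (rule alg_contour_integrable_weakly_holomorphic)
  let ?S = "{z. Re z > 0} - spectrum a"
  have "?S = {z. Re z > 0} \<inter> - spectrum a" by auto
  then show "open ?S" by (simp add: open_Int open_halfspace_Re_gt open_resolvent_set)
  have pos: "z \<notin> \<real>\<^sub>\<le>\<^sub>0" if "z \<in> ?S" for z using that by (auto simp: complex_nonpos_Reals_iff)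
  have disj: "?S \<inter> spectrum a = {}" by auto
  have "(\<lambda>z. z powr complex_of_real \<alpha>) holomorphic_on ?S"
    using pos by (intro holomorphic_intros) auto
  then show "weakly_holomorphic_on (\<lambda>z. (z powr complex_of_real \<alpha>) *\<^sub>C resolvent a z) ?S"
    unfolding weakly_holomorphic_on_def
    by (auto simp: bounded_functional_linear(4) intro!: continuous_on_scaleC holomorphic_on_mult
        holomorphic_on_resolvent continuous_on_resolvent dest: holomorphic_on_imp_continuous_on)
  show "valid_path \<gamma>" "path_image \<gamma> \<subseteq> ?S" using assms by (auto simp: encloses_spectrum_def)
qed

text \<open>The scale \<open>C\<close> has to fit the curve that the definition of the power selects.\<close>

lemma rpow_eq_binomial_series_some_curve:
  fixes a :: "'a::complex_banach_algebra"
  assumes \<gamma>: "encloses_spectrum \<gamma> a" "\<gamma> = (SOME \<gamma>. encloses_spectrum \<gamma> a)"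
    and C: "C > 0" "path_image \<gamma> \<subseteq> ball (of_real C) C"
    and u: "powers_dominated ((1 / C) *\<^sub>R a - 1) s" "s < 1"
  shows "rpow a \<alpha> = (C powr \<alpha>) *\<^sub>R binomial_series \<alpha> ((1 / C) *\<^sub>R a - 1)"
proof (rule eqI_functional)
  fix \<phi> :: "'a \<Rightarrow> complex" assume \<phi>: "bounded_functional \<phi>"
  note lin = bounded_functional_linear[OF \<phi>]
  let ?F = "\<lambda>z. (z powr complex_of_real \<alpha>) *\<^sub>C resolvent a z"
  have "((\<lambda>z. \<phi> (?F z)) has_contour_integral \<phi> (alg_contour_integral \<gamma> ?F)) \<gamma>"
    by (rule functional_alg_contour_integral[OF \<phi> alg_contour_integrable_power_resolvent[OF \<gamma>(1)]])
  then have "\<phi> (alg_contour_integral \<gamma> ?F) =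
      2 * pi * \<i> * \<phi> ((C powr \<alpha>) *\<^sub>R binomial_series \<alpha> ((1 / C) *\<^sub>R a - 1))"
    using contour_integral_power_resolvent[OF \<phi> \<gamma>(1) C u] has_contour_integral_unique
    by (fastforce simp: lin)
  then show "\<phi> (rpow a \<alpha>) = \<phi> ((C powr \<alpha>) *\<^sub>R binomial_series \<alpha> ((1 / C) *\<^sub>R a - 1))"
    by (simp add: rpow_def Let_def lin flip: \<gamma>(2))
qed

text \<open>
  One scale \<open>C\<close> serves all exponents at once, so that the algebra of powers becomes an algebra of
  binomial series. It can moreover be chosen so large that the disc about \<open>C\<close> contains any given
  compact set \<open>K\<close>. With another admissible curve as \<open>K\<close> this shows that the power does not
  depend on the curve.
\<close>

lemma rpow_eq_binomial_series:
  fixes a :: "'a::complex_banach_algebra"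
  assumes a: "positive_spectrum a" and K: "compact K" "K \<subseteq> {z. Re z > 0}"
  obtains C s where "C > 0" "0 < s" "s < 1" "powers_dominated ((1 / C) *\<^sub>R a - 1) s"
    "K \<subseteq> ball (of_real C) C"
    "\<And>\<alpha>. rpow a \<alpha> = (C powr \<alpha>) *\<^sub>R binomial_series \<alpha> ((1 / C) *\<^sub>R a - 1)"
proof -
  define \<gamma> where "\<gamma> = (SOME \<gamma>. encloses_spectrum \<gamma> a)"
  have \<gamma>: "encloses_spectrum \<gamma> a"
    unfolding \<gamma>_def using ex_encloses_spectrum[OF a] by (metis someI_ex)
  have "compact (path_image \<gamma> \<union> K)" "path_image \<gamma> \<union> K \<subseteq> {z. Re z > 0}"
    using \<gamma> K by (auto simp: encloses_spectrum_def valid_path_imp_path compact_path_image)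
  then obtain C0 where C0: "\<And>C. C \<ge> C0 \<Longrightarrow> C > 0 \<Longrightarrow> path_image \<gamma> \<union> K \<subseteq> ball (of_real C) C"
    using compact_right_half_plane_subset_ball by metis
  define C where "C = max C0 (norm a + 1)"
  have C: "C > norm a" "C \<ge> C0" by (auto simp: C_def)
  have Cpos: "C > 0" using C(1) norm_ge_zero[of a] by linarith
  obtain s where s: "0 < s" "s < 1" "powers_dominated ((1 / C) *\<^sub>R a - 1) s"
    using rescaled_powers_dominated[OF a C(1)] by blast
  show ?thesis
  proof
    show "rpow a \<alpha> = (C powr \<alpha>) *\<^sub>R binomial_series \<alpha> ((1 / C) *\<^sub>R a - 1)" for \<alpha>
      using C0[OF C(2) Cpos]
      by (intro rpow_eq_binomial_series_some_curve[OF \<gamma> \<gamma>_def Cpos _ s(3,2)]) auto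
  qed (use Cpos s C0[OF C(2) Cpos] in auto)
qed

lemma functional_rpow:
  fixes a :: "'a::complex_banach_algebra"
  assumes \<phi>: "bounded_functional \<phi>" and a: "positive_spectrum a" and \<gamma>: "encloses_spectrum \<gamma> a"
  shows "2 * pi * \<i> * \<phi> (rpow a \<alpha>) = contour_integral \<gamma> (\<lambda>z. z powr of_real \<alpha> * \<phi> (resolvent a z))"
proof -
  have "compact (path_image \<gamma>)" "path_image \<gamma> \<subseteq> {z. Re z > 0}"
    using \<gamma> by (auto simp: encloses_spectrum_def valid_path_imp_path compact_path_image)
  then obtain C s where C: "C > 0" "s < 1" "powers_dominated ((1 / C) *\<^sub>R a - 1) s"
      "path_image \<gamma> \<subseteq> ball (of_real C) C"
      "\<And>\<alpha>. rpow a \<alpha> = (C powr \<alpha>) *\<^sub>R binomial_series \<alpha> ((1 / C) *\<^sub>R a - 1)"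
    using rpow_eq_binomial_series[OF a] by metis
  show ?thesis
    unfolding C(5)
    by (rule contour_integral_unique[symmetric, OF contour_integral_power_resolvent[OF \<phi> \<gamma> C(1,4,3,2)]])
qed

lemma rpow_add:
  fixes a :: "'a::complex_banach_algebra"
  assumes a: "positive_spectrum a"
  shows "rpow a \<alpha> * rpow a \<beta> = rpow a (\<alpha> + \<beta>)"
proof -
  obtain C s where C: "C > 0" "s < 1" "powers_dominated ((1 / C) *\<^sub>R a - 1) s"
      "\<And>\<alpha>. rpow a \<alpha> = (C powr \<alpha>) *\<^sub>R binomial_series \<alpha> ((1 / C) *\<^sub>R a - 1)"
    using rpow_eq_binomial_series[OF a, of "{}"] by (metis compact_empty empty_subsetI)
  show ?thesis
    by (simp add: C(4) binomial_series_add[OF C(3,2)] powr_add)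
qed

lemma rpow_0:
  assumes a: "positive_spectrum (a::'a::complex_banach_algebra)"
  shows "rpow a 0 = 1"
proof -
  obtain C where "C > 0" "\<And>\<alpha>. rpow a \<alpha> = (C powr \<alpha>) *\<^sub>R binomial_series \<alpha> ((1 / C) *\<^sub>R a - 1)"
    using rpow_eq_binomial_series[OF a, of "{}"] by (metis compact_empty empty_subsetI)
  then show ?thesis by simp
qed

lemma rpow_1:
  assumes a: "positive_spectrum (a::'a::complex_banach_algebra)"
  shows "rpow a 1 = a"
proof -
  obtain C where "C > 0" "\<And>\<alpha>. rpow a \<alpha> = (C powr \<alpha>) *\<^sub>R binomial_series \<alpha> ((1 / C) *\<^sub>R a - 1)"
    using rpow_eq_binomial_series[OF a, of "{}"] by (metis compact_empty empty_subsetI)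
  then show ?thesis by simp
qed

section \<open>Powers of similar elements and of inverses\<close>

lemma bounded_functional_sandwich:
  assumes "bounded_functional \<phi>"
  shows "bounded_functional (\<lambda>x. \<phi> (s * x * t))"
  unfolding bounded_functional_def
proof (intro conjI allI)
  show "bounded_linear (\<lambda>x. \<phi> (s * x * t))"
    using bounded_linear_compose[OF bounded_functional_linear(1)[OF assms]
        bounded_linear_compose[OF bounded_linear_mult_left[of t] bounded_linear_mult_right[of s]]]
    by simp
qed (simp add: mult_scaleC_left mult_scaleC_right bounded_functional_linear(4)[OF assms])

context
  fixes a s t :: "'a::complex_banach_algebra"
  assumes st: "s * t = 1" "t * s = 1"
begin

lemma similar_shift: "z *\<^sub>C 1 - s * a * t = s * (z *\<^sub>C 1 - a) * t"
  by (simp add: right_diff_distrib left_diff_distrib mult_scaleC_left mult_scaleC_right st)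

lemma similar_invertible: "is_invertible s" "is_invertible t"
  using st by (auto intro: is_invertibleI)

lemma spectrum_similar: "spectrum (s * a * t) = spectrum a"
proof -
  have "is_invertible (s * x * t) \<longleftrightarrow> is_invertible x" for x
  proof
    assume "is_invertible (s * x * t)"
    then have "is_invertible (t * (s * x * t) * s)"
      by (rule is_invertible_mult[OF is_invertible_mult[OF similar_invertible(2)] similar_invertible(1)])
    moreover have "t * (s * x * t) * s = (t * s) * x * (t * s)" by (simp only: mult.assoc)
    ultimately have "is_invertible ((t * s) * x * (t * s))" by (simp only:)
    then show "is_invertible x" by (simp add: st)
  qed (intro is_invertible_mult similar_invertible)
  then show ?thesis by (simp add: spectrum_def similar_shift)
qed

lemma rpow_similar:
  assumes a: "positive_spectrum a"
  shows "rpow (s * a * t) \<alpha> = s * rpow a \<alpha> * t"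
proof (rule eqI_functional)
  fix \<phi> :: "'a \<Rightarrow> complex" assume \<phi>: "bounded_functional \<phi>"
  obtain \<gamma> where \<gamma>: "encloses_spectrum \<gamma> a" using ex_encloses_spectrum[OF a] by blast
  have res: "resolvent (s * a * t) z = s * resolvent a z * t" if "z \<notin> spectrum a" for z
    using that st unfolding similar_shift
    by (subst ring_inverse_mult ring_inverse_mult[of s] | simp add: similar_invertible not_in_spectrum_iff
        ring_inverse_eqI[of s t] ring_inverse_eqI[of t s] mult.assoc)+
  have "2 * pi * \<i> * \<phi> (rpow (s * a * t) \<alpha>) =
      contour_integral \<gamma> (\<lambda>z. z powr of_real \<alpha> * \<phi> (resolvent (s * a * t) z))"
    using a \<gamma> by (intro functional_rpow \<phi>)
      (simp_all add: positive_spectrum_def encloses_spectrum_def spectrum_similar)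
  also have "\<dots> = contour_integral \<gamma> (\<lambda>z. z powr of_real \<alpha> * \<phi> (s * resolvent a z * t))"
    using \<gamma> by (intro contour_integral_cong refl) (auto simp: encloses_spectrum_def res)
  also have "\<dots> = 2 * pi * \<i> * \<phi> (s * rpow a \<alpha> * t)"
    by (rule functional_rpow[OF bounded_functional_sandwich[OF \<phi>] a \<gamma>, symmetric])
  finally show "\<phi> (rpow (s * a * t) \<alpha>) = \<phi> (s * rpow a \<alpha> * t)" by simp
qed

end

lemma positive_spectrum_invertible:
  assumes "positive_spectrum (a::'a::complex_banach_algebra)"
  shows "is_invertible a"
proof -
  have "0 \<notin> spectrum a" using positive_spectrumD[OF assms] by fastforce
  then show ?thesis by (simp add: not_in_spectrum_iff)
qed

lemma inverse_shift:
  fixes a :: "'a::complex_banach_algebra"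
  assumes "is_invertible a" "z \<noteq> 0"
  shows "((- z) *\<^sub>C a) * ((1 / z) *\<^sub>C 1 - ring_inverse a) = z *\<^sub>C 1 - a"
    and "((1 / z) *\<^sub>C 1 - ring_inverse a) * ((- z) *\<^sub>C a) = z *\<^sub>C 1 - a"
  using assms by (simp_all add: right_diff_distrib left_diff_distrib mult_scaleC_left
      mult_scaleC_right scaleC_scaleC scaleC_minus_left scaleC_minus_right scaleC_diff_right)

lemma ring_inverse_ring_inverse [simp]: "is_invertible a \<Longrightarrow> ring_inverse (ring_inverse a) = a"
  by (intro ring_inverse_eqI) auto

lemma spectrum_ring_inverse:
  fixes a :: "'a::complex_banach_algebra"
  assumes a: "is_invertible a"
  shows "spectrum (ring_inverse a) = inverse ` spectrum a"
proof -
  have sub: "inverse w \<in> spectrum a" "w \<noteq> 0"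
    if a: "is_invertible a" and w: "w \<in> spectrum (ring_inverse a)" for w and a :: 'a
  proof -
    show "w \<noteq> 0" using that by (auto simp: spectrum_def)
    show "inverse w \<in> spectrum a"
    proof (rule ccontr)
      assume "inverse w \<notin> spectrum a"
      then have "is_invertible (inverse w *\<^sub>C 1 - a)" by (simp add: not_in_spectrum_iff)
      then have "is_invertible (((- w) *\<^sub>C ring_inverse a) * ((1 / w) *\<^sub>C 1 - a))"
        using a \<open>w \<noteq> 0\<close>
        by (intro is_invertible_mult) (simp_all add: is_invertible_scaleC inverse_eq_divide)
      moreover have "((- w) *\<^sub>C ring_inverse a) * ((1 / w) *\<^sub>C 1 - a) = w *\<^sub>C 1 - ring_inverse a"
        using inverse_shift(1)[of "ring_inverse a" w] a \<open>w \<noteq> 0\<close> by simp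
      ultimately show False using w by (simp add: spectrum_def)
    qed
  qed
  show ?thesis
  proof (intro equalityI subsetI)
    fix w assume "w \<in> spectrum (ring_inverse a)"
    then show "w \<in> inverse ` spectrum a" using sub[OF a] by (force simp: image_iff)
  next
    fix w assume "w \<in> inverse ` spectrum a"
    then show "w \<in> spectrum (ring_inverse a)"
      using sub(1)[of "ring_inverse a"] a by auto
  qed
qed

lemma positive_spectrum_ring_inverse:
  fixes a :: "'a::complex_banach_algebra"
  assumes "positive_spectrum a"
  shows "positive_spectrum (ring_inverse a)"
  unfolding positive_spectrum_def spectrum_ring_inverse[OF positive_spectrum_invertible[OF assms]]
proof
  fix z assume "z \<in> inverse ` spectrum a"
  then obtain r where "r > 0" "z = inverse (of_real r)" using positive_spectrumD[OF assms] by blast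
  then show "z \<in> complex_of_real ` {0<..}" by (intro image_eqI[of _ _ "inverse r"]) auto
qed

text \<open>
  The inversion \<open>z \<mapsto> 1 / z\<close> carries a curve about the spectrum of \<open>a\<close> to a curve about the
  spectrum of the inverse, and the Cauchy integrals correspond under this substitution.
\<close>

lemma rpow_ring_inverse:
  fixes a :: "'a::complex_banach_algebra"
  assumes a: "positive_spectrum a"
  shows "rpow (ring_inverse a) \<alpha> = rpow a (- \<alpha>)"
proof (rule eqI_functional)
  fix \<phi> :: "'a \<Rightarrow> complex" assume \<phi>: "bounded_functional \<phi>"
  note lin = bounded_functional_linear[OF \<phi>]
  obtain \<gamma> where \<gamma>: "encloses_spectrum \<gamma> a" using ex_encloses_spectrum[OF a] by blast
  have inv: "is_invertible a" by (rule positive_spectrum_invertible[OF a])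
  have vp: "valid_path \<gamma>" and loop: "pathfinish \<gamma> = pathstart \<gamma>"
    and img: "path_image \<gamma> \<subseteq> {z. Re z > 0} - spectrum a"
    and wind: "\<And>z. z \<in> spectrum a \<Longrightarrow> winding_number \<gamma> z = 1"
    using \<gamma> by (auto simp: encloses_spectrum_def)
  have 0: "0 \<notin> path_image \<gamma>" using img by auto
  have wind0: "winding_number \<gamma> 0 = 0"
  proof (rule winding_number_zero_outside[where s = "{z. Re z > 0}"])
    show "path \<gamma>" using vp by (rule valid_path_imp_path)
    show "convex {z. Re z > 0}" by (rule convex_halfspace_Re_gt)
  qed (use loop img in auto)
  let ?g = "\<lambda>z::complex. 1 / (z - 0)"
  have \<gamma>': "encloses_spectrum (?g \<circ> \<gamma>) (ring_inverse a)"
    unfolding encloses_spectrum_def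
  proof (intro conjI ballI)
    show "valid_path (?g \<circ> \<gamma>)" by (rule valid_path_inversion[OF vp 0])
    show "pathfinish (?g \<circ> \<gamma>) = pathstart (?g \<circ> \<gamma>)"
      using loop by (simp add: pathfinish_def pathstart_def)
    show "path_image (?g \<circ> \<gamma>) \<subseteq> {z. Re z > 0} - spectrum (ring_inverse a)"
    proof
      fix w assume "w \<in> path_image (?g \<circ> \<gamma>)"
      then obtain z where z: "z \<in> path_image \<gamma>" "w = inverse z"
        by (auto simp: path_image_compose inverse_eq_divide)
      then have "Re z > 0" "z \<notin> spectrum a" using img by auto
      moreover have "Re w > 0" using z(2) \<open>Re z > 0\<close>
        by (simp add: Re_complex_div_gt_0 inverse_eq_divide) 
      moreover have "w \<notin> inverse ` spectrum a" using \<open>z \<notin> spectrum a\<close> z(2) by auto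
      ultimately show "w \<in> {z. Re z > 0} - spectrum (ring_inverse a)"
        by (simp add: spectrum_ring_inverse[OF inv])
    qed
    fix w assume "w \<in> spectrum (ring_inverse a)"
    then obtain k where k: "k \<in> spectrum a" "w = ?g k"
      by (auto simp: spectrum_ring_inverse[OF inv] inverse_eq_divide)
    have "k \<noteq> 0" using positive_spectrumD[OF a k(1)] by auto
    then show "winding_number (?g \<circ> \<gamma>) w = 1"
      unfolding k(2) using winding_number_inversion[OF vp 0, of k] img k(1) wind wind0 by auto
  qed
  have "2 * pi * \<i> * \<phi> (rpow (ring_inverse a) \<alpha>) =
      contour_integral (?g \<circ> \<gamma>) (\<lambda>w. w powr of_real \<alpha> * \<phi> (resolvent (ring_inverse a) w))"
    by (rule functional_rpow[OF \<phi> positive_spectrum_ring_inverse[OF a] \<gamma>'])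
  also have "\<dots> = contour_integral \<gamma>
      (\<lambda>z. - (?g z powr of_real \<alpha> * \<phi> (resolvent (ring_inverse a) (?g z))) / (z - 0)\<^sup>2)"
    by (rule contour_integral_inversion[OF vp 0])
  also have "\<dots> = contour_integral \<gamma> (\<lambda>z. z powr of_real (- \<alpha> - 1) * \<phi> (a * resolvent a z * 1))"
  proof (rule contour_integral_cong)
    fix z assume "z \<in> path_image \<gamma>"
    then have z: "Re z > 0" "z \<noteq> 0" "z \<notin> spectrum a" "is_invertible (z *\<^sub>C 1 - a)"
      using img by (auto simp: spectrum_def)
    have res: "resolvent (ring_inverse a) (1 / z) = (- z) *\<^sub>C (a * resolvent a z)"
    proof (rule ring_inverse_eqI)
      have comm: "a * resolvent a z = resolvent a z * a"
        using z(4) by (intro ring_inverse_commute[symmetric])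
          (simp_all add: left_diff_distrib right_diff_distrib mult_scaleC_left mult_scaleC_right)
      note L = inverse_shift[OF inv z(2)]
      have "((1 / z) *\<^sub>C 1 - ring_inverse a) * ((- z) *\<^sub>C (a * resolvent a z)) =
          ((1 / z) *\<^sub>C 1 - ring_inverse a) * ((- z) *\<^sub>C a) * resolvent a z"
        by (simp add: mult_scaleC_left mult.assoc)
      then show "((1 / z) *\<^sub>C 1 - ring_inverse a) * ((- z) *\<^sub>C (a * resolvent a z)) = 1"
        using z(4) by (simp only: L ring_inverse_right)
      have "((- z) *\<^sub>C (a * resolvent a z)) * ((1 / z) *\<^sub>C 1 - ring_inverse a) =
          resolvent a z * (((- z) *\<^sub>C a) * ((1 / z) *\<^sub>C 1 - ring_inverse a))"
        unfolding comm by (simp add: mult_scaleC_left mult_scaleC_right mult.assoc)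
      then show "((- z) *\<^sub>C (a * resolvent a z)) * ((1 / z) *\<^sub>C 1 - ring_inverse a) = 1"
        using z(4) by (simp only: L ring_inverse_left)
    qed
    have "z \<notin> \<real>\<^sub>\<le>\<^sub>0" using z(1) by (auto simp: complex_nonpos_Reals_iff)
    then have "(1 / z) powr of_real \<alpha> = z powr of_real (- \<alpha>)"
      using z(2) by (simp add: powr_def Ln_inverse flip: inverse_eq_divide)
    also have "\<dots> = z * z powr of_real (- \<alpha> - 1)"
      using z(2) by (simp add: powr_diff)
    finally have pow: "(1 / z) powr of_real \<alpha> = z * z powr of_real (- \<alpha> - 1)" .
    show "- (?g z powr of_real \<alpha> * \<phi> (resolvent (ring_inverse a) (?g z))) / (z - 0)\<^sup>2 =
        z powr of_real (- \<alpha> - 1) * \<phi> (a * resolvent a z * 1)"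
      unfolding diff_zero res pow using z(2) by (simp add: lin power2_eq_square)
  qed simp
  also have "\<dots> = 2 * pi * \<i> * \<phi> (a * rpow a (- \<alpha> - 1) * 1)"
    by (rule functional_rpow[OF bounded_functional_sandwich[OF \<phi>] a \<gamma>, symmetric])
  also have "a * rpow a (- \<alpha> - 1) = rpow a (- \<alpha>)"
    using rpow_add[OF a, of 1 "- \<alpha> - 1"] by (simp add: rpow_1[OF a])
  finally show "\<phi> (rpow (ring_inverse a) \<alpha>) = \<phi> (rpow a (- \<alpha>))" by simp
qed

section \<open>Square roots of selfadjoint elements\<close>

lemma star_zero [simp]: "(0::'a::banach_star_algebra)\<^sup>\<star> = 0"
  using star_add[of "0::'a" 0] by simp

lemma star_minus: "(- x::'a::banach_star_algebra)\<^sup>\<star> = - x\<^sup>\<star>"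
  using star_add[of x "- x"] by (simp add: eq_neg_iff_add_eq_0 add.commute)

lemma star_diff: "(x - y::'a::banach_star_algebra)\<^sup>\<star> = x\<^sup>\<star> - y\<^sup>\<star>"
  using star_add[of x "- y"] by (simp add: star_minus)

lemma star_one [simp]: "(1::'a::banach_star_algebra)\<^sup>\<star> = 1"
  by (metis mult_1_left mult_1_right star_mult star_star)

lemma star_scaleR: "(r *\<^sub>R x::'a::banach_star_algebra)\<^sup>\<star> = r *\<^sub>R x\<^sup>\<star>"
  using star_scaleC[of "of_real r" x] by (simp add: scaleC_of_real)

lemma star_power: "(x ^ n::'a::banach_star_algebra)\<^sup>\<star> = (x\<^sup>\<star>) ^ n"
  by (induction n) (simp_all add: star_mult power_commutes)

lemma is_invertible_star [simp]: "is_invertible (x\<^sup>\<star>) \<longleftrightarrow> is_invertible (x::'a::banach_star_algebra)"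
proof -
  have "is_invertible (x\<^sup>\<star>)" if "is_invertible x" for x :: 'a
    using that by (intro is_invertibleI[of _ "(ring_inverse x)\<^sup>\<star>"]) (simp_all flip: star_mult)
  from this[of x] this[of "x\<^sup>\<star>"] show ?thesis by (auto simp: star_star)
qed

lemma star_ring_inverse:
  assumes "is_invertible (x::'a::banach_star_algebra)"
  shows "(ring_inverse x)\<^sup>\<star> = ring_inverse (x\<^sup>\<star>)"
  using assms by (intro ring_inverse_eqI[symmetric]) (simp_all flip: star_mult)

lemma spectrum_star: "spectrum (x\<^sup>\<star>) = cnj ` spectrum (x::'a::banach_star_algebra)"
proof -
  have "z \<in> spectrum (x\<^sup>\<star>) \<longleftrightarrow> cnj z \<in> spectrum x" for z
  proof -
    have "z *\<^sub>C 1 - x\<^sup>\<star> = (cnj z *\<^sub>C 1 - x)\<^sup>\<star>" by (simp add: star_diff star_scaleC)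
    then show ?thesis by (simp add: spectrum_def)
  qed
  then have "spectrum (x\<^sup>\<star>) = cnj -` spectrum x" by auto
  also have "\<dots> = cnj ` spectrum x" by (auto intro: image_eqI[of _ _ "cnj _"])
  finally show ?thesis .
qed

text \<open>
  The induction estimates \<open>(x + y)\<^sup>n * x\<^sup>i * y\<^sup>j\<close> for all \<open>i\<close> and \<open>j\<close> instead of expanding the power
  of the sum.
\<close>

lemma powers_dominated_add_commuting:
  fixes x y :: "'a::{real_normed_algebra,ring_1}"
  assumes x: "powers_dominated x a" and y: "powers_dominated y b" and comm: "x * y = y * x"
  shows "powers_dominated (x + y) (a + b)"
proof -
  obtain M where M: "M > 0" "\<And>n. norm (x ^ n) \<le> M * a ^ n" using x powers_dominatedE by metis
  obtain N where N: "N > 0" "\<And>n. norm (y ^ n) \<le> N * b ^ n" using y powers_dominatedE by metis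
  have ab: "a \<ge> 0" "b \<ge> 0" using x y by (auto simp: powers_dominated_def)
  have "norm ((x + y) ^ n * (x ^ i * y ^ j)) \<le> M * N * (a + b) ^ n * (a ^ i * b ^ j)" for n i j
  proof (induction n arbitrary: i j)
    case 0
    have "norm (x ^ i * y ^ j) \<le> norm (x ^ i) * norm (y ^ j)" by (rule norm_mult_ineq)
    also have "\<dots> \<le> (M * a ^ i) * (N * b ^ j)"
      using M(1) ab by (intro mult_mono M(2) N(2)) auto
    finally show ?case by (simp add: mult_ac)
  next
    case (Suc n)
    have "y * x ^ i = x ^ i * y" using comm by (metis power_commuting_commutes)
    then have eq: "(x + y) * (x ^ i * y ^ j) = x ^ Suc i * y ^ j + x ^ i * y ^ Suc j"
      by (simp add: distrib_right flip: mult.assoc)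
    have "(x + y) ^ Suc n * (x ^ i * y ^ j) = (x + y) ^ n * ((x + y) * (x ^ i * y ^ j))"
      by (simp only: power_Suc2 mult.assoc)
    also have "\<dots> = (x + y) ^ n * (x ^ Suc i * y ^ j) + (x + y) ^ n * (x ^ i * y ^ Suc j)"
      by (simp only: eq distrib_left)
    finally have "norm ((x + y) ^ Suc n * (x ^ i * y ^ j)) \<le>
        M * N * (a + b) ^ n * (a ^ Suc i * b ^ j) + M * N * (a + b) ^ n * (a ^ i * b ^ Suc j)"
      using norm_triangle_mono[OF Suc.IH[of "Suc i" j] Suc.IH[of i "Suc j"]] by simp
    then show ?case by (simp add: algebra_simps)
  qed
  from this[of _ 0 0] show ?thesis using ab by (auto simp: powers_dominated_def)
qed

lemma half_gchoose_sign: "(-1) ^ n * ((1/2::real) gchoose Suc n) \<ge> 0"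
proof (induction n)
  case (Suc n)
  have "(1/2) * ((1/2::real) gchoose Suc n) =
      of_nat (Suc n) * (1/2 gchoose Suc n) + of_nat (Suc (Suc n)) * (1/2 gchoose Suc (Suc n))"
    by (rule gbinomial_mult_1)
  then have "(1/2::real) gchoose Suc (Suc n) =
      - ((real n + 1/2) / (real n + 2)) * (1/2 gchoose Suc n)"
    by (simp add: field_simps)
  then have "(-1) ^ Suc n * ((1/2::real) gchoose Suc (Suc n)) =
      (real n + 1/2) / (real n + 2) * ((-1) ^ n * (1/2 gchoose Suc n))" by simp
  also have "\<dots> \<ge> 0" by (rule mult_nonneg_nonneg[OF _ Suc]) simp
  finally show ?case .
qed simp

text \<open>
  The Taylor coefficients of \<open>1 - sqrt (1 - t)\<close> are nonnegative. Estimating the series of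
  \<open>v = 1 - sqrt (1 + u)\<close> term by term therefore gives the value \<open>1 - sqrt (1 - s)\<close>, which is below
  \<open>1\<close>. The induction on \<open>k\<close> estimates \<open>v\<^sup>k * u\<^sup>m\<close> for all \<open>m\<close>, so that the constant in the domination
  of the powers of \<open>u\<close> enters only once and not in every step.
\<close>

lemma powers_dominated_one_minus_sqrt:
  fixes u :: "'a::complex_banach_algebra"
  assumes u: "powers_dominated u s" "s < 1"
  shows "powers_dominated (1 - binomial_series (1/2) u) (1 - sqrt (1 - s))"
proof -
  have s: "s \<ge> 0" using u by (simp add: powers_dominated_def)
  define q where "q = 1 - sqrt (1 - s)"
  define v where "v = 1 - binomial_series (1/2) u"
  have q: "q \<ge> 0" using s by (simp add: q_def)
  let ?c = "\<lambda>n. (1/2::real) gchoose n"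
  have abs: "\<bar>?c (Suc n)\<bar> = (-1) ^ n * ?c (Suc n)" for n
    using half_gchoose_sign[of n] by (cases "even n") auto
  have "(\<lambda>n. ?c n * (- s) ^ n) sums (1 + (- s)) powr (1/2)"
    using s u(2) by (intro gen_binomial_real) auto
  then have "(\<lambda>n. ?c (Suc n) * (- s) ^ Suc n) sums (sqrt (1 - s) - 1)"
    using u(2) by (subst sums_Suc_iff) (simp add: powr_half_sqrt)
  from sums_minus[OF this] have qsum: "(\<lambda>n. \<bar>?c (Suc n)\<bar> * s ^ Suc n) sums q"
    by (simp add: q_def abs power_minus[of s] mult_ac)
  have "(\<lambda>n. ?c (Suc n) *\<^sub>R u ^ Suc n) sums (binomial_series (1/2) u - 1)"
    using binomial_series_sums(2)[OF u, of "1/2"] by (subst sums_Suc_iff) simp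
  from sums_minus[OF this] have vsum: "(\<lambda>n. - (?c (Suc n) *\<^sub>R u ^ Suc n)) sums v"
    by (simp add: v_def)
  obtain M where M: "M > 0" "\<And>n. norm (u ^ n) \<le> M * s ^ n" using u powers_dominatedE by metis
  have "norm (v ^ k * u ^ m) \<le> M * q ^ k * s ^ m" for k m
  proof (induction k arbitrary: m)
    case (Suc k)
    have "(\<lambda>n. v ^ k * (- (?c (Suc n) *\<^sub>R u ^ Suc n)) * u ^ m) sums (v ^ k * v * u ^ m)"
      by (intro bounded_linear.sums[OF bounded_linear_mult_left]
          bounded_linear.sums[OF bounded_linear_mult_right] vsum)
    then have eq: "v ^ Suc k * u ^ m = (\<Sum>n. v ^ k * (- (?c (Suc n) *\<^sub>R u ^ Suc n)) * u ^ m)"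
      by (simp only: power_Suc2 sums_iff)
    have le: "norm (v ^ k * (- (?c (Suc n) *\<^sub>R u ^ Suc n)) * u ^ m) \<le>
        (M * q ^ k * s ^ m) * (\<bar>?c (Suc n)\<bar> * s ^ Suc n)" for n
    proof -
      have "v ^ k * (- (?c (Suc n) *\<^sub>R u ^ Suc n)) * u ^ m = - (?c (Suc n) *\<^sub>R (v ^ k * u ^ (Suc n + m)))"
        by (simp only: mult_minus_left mult_minus_right mult_scaleR_left mult_scaleR_right mult.assoc power_add)
      then have "norm (v ^ k * (- (?c (Suc n) *\<^sub>R u ^ Suc n)) * u ^ m) =
          \<bar>?c (Suc n)\<bar> * norm (v ^ k * u ^ (Suc n + m))"
        by (simp only: norm_minus_cancel norm_scaleR)
      also have "\<dots> \<le> \<bar>?c (Suc n)\<bar> * (M * q ^ k * s ^ (Suc n + m))"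
        by (intro mult_left_mono Suc.IH) auto
      finally show ?thesis by (simp add: power_add mult_ac)
    qed
    have "norm (v ^ Suc k * u ^ m) \<le> (\<Sum>n. (M * q ^ k * s ^ m) * (\<bar>?c (Suc n)\<bar> * s ^ Suc n))"
      unfolding eq by (intro norm_suminf_le le summable_mult sums_summable[OF qsum])
    also have "\<dots> = (M * q ^ k * s ^ m) * q"
      using sums_mult[OF qsum] by (simp only: sums_iff)
    finally show ?case by (simp add: mult_ac)
  qed (use M in simp)
  from this[of _ 0] show ?thesis using q by (auto simp: powers_dominated_def v_def q_def)
qed

text \<open>
  Ford's square root lemma. The involution need not be continuous, so the binomial series alone
  does not show that the root is selfadjoint. Instead the root is unique: if \<open>v\<close> and \<open>v\<^sup>\<star>\<close> both
  solve \<open>(1 - v)\<^sup>2 = 1 + u\<close> with spectral radius below \<open>1\<close>, then they commute and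
  \<open>(v - v\<^sup>\<star>) * (2 - v - v\<^sup>\<star>) = 0\<close> with an invertible second factor.
\<close>

lemma selfadjoint_rpow_half:
  fixes p :: "'a::banach_star_algebra"
  assumes sa: "selfadjoint p" and p: "positive_spectrum p"
  shows "selfadjoint (rpow p (1/2))"
proof -
  obtain C s where C: "C > 0" and s: "s < 1"
    and dom: "powers_dominated ((1 / C) *\<^sub>R p - 1) s"
    and rp: "\<And>\<alpha>. rpow p \<alpha> = (C powr \<alpha>) *\<^sub>R binomial_series \<alpha> ((1 / C) *\<^sub>R p - 1)"
    using rpow_eq_binomial_series[OF p, of "{}"] by (metis compact_empty empty_subsetI)
  define u where "u = (1 / C) *\<^sub>R p - 1"
  define v where "v = 1 - binomial_series (1/2) u"
  have us: "u\<^sup>\<star> = u" using sa by (simp add: u_def selfadjoint_def star_diff star_scaleR)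
  have sq: "(1 - v) * (1 - v) = 1 + u"
    using binomial_series_add[OF dom[folded u_def] s, of "1/2" "1/2"] by (simp add: v_def)
  then have "((1 - v) * (1 - v))\<^sup>\<star> = (1 + u)\<^sup>\<star>" by simp
  then have sq': "(1 - v\<^sup>\<star>) * (1 - v\<^sup>\<star>) = 1 + u"
    by (simp add: star_mult star_diff star_add us)
  define q where "q = 1 - sqrt (1 - s)"
  have q: "q < 1" using s by (simp add: q_def)
  have v: "powers_dominated v q"
    unfolding v_def q_def using powers_dominated_one_minus_sqrt[OF dom s] by (simp add: u_def)
  have "spectrum (v\<^sup>\<star>) \<subseteq> ball 0 1"
    using spectrum_subset_cball[OF v] q by (force simp: spectrum_star)
  then obtain t where t: "t < 1" "powers_dominated (v\<^sup>\<star>) t"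
    using powers_dominated_of_spectrum by (metis zero_less_one)
  have u_eq: "u = (1 - v\<^sup>\<star>) * (1 - v\<^sup>\<star>) - 1" using sq' by simp
  have "v\<^sup>\<star> * u = u * v\<^sup>\<star>" unfolding u_eq by (simp add: algebra_simps)
  then have comm_pow: "v\<^sup>\<star> * u ^ n = u ^ n * v\<^sup>\<star>" for n by (metis power_commuting_commutes)
  have B: "(\<lambda>n. (1/2 gchoose n) *\<^sub>R u ^ n) sums binomial_series (1/2) u"
    by (rule binomial_series_sums(2)[OF dom[folded u_def] s])
  have "v\<^sup>\<star> * binomial_series (1/2) u = binomial_series (1/2) u * v\<^sup>\<star>"
    using bounded_linear.sums[OF bounded_linear_mult_right[of "v\<^sup>\<star>"] B]
      bounded_linear.sums[OF bounded_linear_mult_left[of "v\<^sup>\<star>"] B] sums_unique2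
    by (simp add: comm_pow)
  then have comm: "v * v\<^sup>\<star> = v\<^sup>\<star> * v" by (simp add: v_def algebra_simps)
  have "powers_dominated ((1/2) *\<^sub>C (v + v\<^sup>\<star>)) (cmod (1/2) * (q + t))"
    by (intro powers_dominated_scaleC powers_dominated_add_commuting v t comm)
  then have "is_invertible (1 - (1/2) *\<^sub>C (v + v\<^sup>\<star>))"
    by (rule neumann_series(1)) (use q t in simp)
  moreover have "(v - v\<^sup>\<star>) * (1 - (1/2) *\<^sub>C (v + v\<^sup>\<star>)) = 0"
  proof -
    have "2 *\<^sub>C ((v - v\<^sup>\<star>) * (1 - (1/2) *\<^sub>C (v + v\<^sup>\<star>))) =
        2 *\<^sub>C (v - v\<^sup>\<star>) - (v - v\<^sup>\<star>) * (v + v\<^sup>\<star>)"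
      by (simp add: right_diff_distrib scaleC_diff_right mult_scaleC_right scaleC_scaleC)
    also have "2 *\<^sub>C (v - v\<^sup>\<star>) = (v - v\<^sup>\<star>) + (v - v\<^sup>\<star>)"
      using scaleC_add_left[of 1 1 "v - v\<^sup>\<star>"] by simp
    also have "(v - v\<^sup>\<star>) + (v - v\<^sup>\<star>) - (v - v\<^sup>\<star>) * (v + v\<^sup>\<star>) =
        (1 - v\<^sup>\<star>) * (1 - v\<^sup>\<star>) - (1 - v) * (1 - v)"
      using comm by (simp add: algebra_simps)
    also have "\<dots> = 0" by (simp add: sq sq')
    finally have "(1/2) *\<^sub>C (2 *\<^sub>C ((v - v\<^sup>\<star>) * (1 - (1/2) *\<^sub>C (v + v\<^sup>\<star>)))) = 0" by simp
    then show ?thesis by (simp only: scaleC_scaleC) simp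
  qed
  ultimately have "v - v\<^sup>\<star> = 0"
    by (metis mult.assoc mult_zero_left mult_1_right ring_inverse_right)
  then have "v\<^sup>\<star> = v" by simp
  moreover have "rpow p (1/2) = (C powr (1/2)) *\<^sub>R (1 - v)" by (simp add: rp v_def u_def)
  ultimately show ?thesis by (simp add: selfadjoint_def star_scaleR star_diff)
qed

lemma rpow_inverse_pairs:
  assumes a: "positive_spectrum (a::'a::complex_banach_algebra)"
  shows "rpow a \<alpha> * rpow a (- \<alpha>) = 1" "rpow a (- \<alpha>) * rpow a \<alpha> = 1"
  by (simp_all add: rpow_add[OF a] rpow_0[OF a])

section \<open>Positivity in Hermitian algebras\<close>

context
  assumes hermitian: "hermitian_algebra TYPE('a::banach_star_algebra)"
begin

lemma selfadjoint_spectrum_real: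
  "selfadjoint (x::'a) \<Longrightarrow> z \<in> spectrum x \<Longrightarrow> z \<in> \<real>"
  using hermitian by (auto simp: hermitian_algebra_def)

text \<open>
  Conjugating with the selfadjoint square root of \<open>p\<close> reduces this to \<open>p = 1\<close>, where it is the
  reality of the spectrum of the selfadjoint element \<open>\<i> d\<close>.
\<close>

lemma is_invertible_positive_plus_skew:
  fixes p d :: 'a
  assumes p: "selfadjoint p" "positive_spectrum p" and d: "d\<^sup>\<star> = - d"
  shows "is_invertible (p + d)"
proof -
  define w where "w = rpow p (1/2)"
  define w' where "w' = rpow p (- (1/2))"
  have ww': "w * w' = 1" "w' * w = 1" unfolding w_def w'_def by (rule rpow_inverse_pairs[OF p(2)])+
  have w2: "w * w = p" unfolding w_def by (simp add: rpow_add[OF p(2)] rpow_1[OF p(2)])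
  have ws: "w\<^sup>\<star> = w" using selfadjoint_rpow_half[OF p] by (simp add: w_def selfadjoint_def)
  have w'_inv: "w' = ring_inverse w" using ww' by (intro ring_inverse_eqI[symmetric])
  have winv: "is_invertible w" using ww' by (intro is_invertibleI)
  have w's: "w'\<^sup>\<star> = w'" by (simp add: w'_inv star_ring_inverse winv ws)
  define m where "m = w' * d * w'"
  have "m\<^sup>\<star> = - m" by (simp add: m_def star_mult w's d mult.assoc)
  then have "selfadjoint (\<i> *\<^sub>C m)" by (simp add: selfadjoint_def star_scaleC scaleC_minus_left scaleC_minus_right)
  then have "- \<i> \<notin> spectrum (\<i> *\<^sub>C m)"
    using selfadjoint_spectrum_real[of "\<i> *\<^sub>C m" "- \<i>"] by (auto simp: complex_is_Real_iff)
  then have "is_invertible ((- \<i>) *\<^sub>C 1 - \<i> *\<^sub>C m)" by (simp add: not_in_spectrum_iff)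
  moreover have "(- \<i>) *\<^sub>C 1 - \<i> *\<^sub>C m = (- \<i>) *\<^sub>C (1 + m)"
    by (simp add: scaleC_add_right scaleC_minus_left)
  ultimately have "is_invertible (1 + m)" by (simp add: is_invertible_scaleC del: minus_diff_eq)
  then have "is_invertible (w * (1 + m) * w)" by (intro is_invertible_mult winv)
  moreover have "w * (1 + m) * w = w * w + (w * w') * d * (w' * w)"
    by (simp add: m_def distrib_left distrib_right mult.assoc)
  ultimately show ?thesis by (simp add: w2 ww')
qed

text \<open>
  The core of Ptak's inequality \<open>r(x)\<^sup>2 \<le> r(x\<^sup>\<star> x)\<close>. The products of \<open>1 - x\<close> with \<open>1 + x\<^sup>\<star>\<close> on either side are
  a positive element, \<open>1 - x\<^sup>\<star> x\<close> or \<open>1 - x x\<^sup>\<star>\<close>, plus the skew element \<open>x\<^sup>\<star> - x\<close>.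
\<close>

lemma is_invertible_one_minus_ptak:
  fixes x :: 'a
  assumes spec: "spectrum (x\<^sup>\<star> * x) \<subseteq> ball 0 1"
  shows "is_invertible (1 - x)"
proof (rule is_invertibleI_one_sided)
  have pos: "selfadjoint (1 - y)" "positive_spectrum (1 - y)"
    if "selfadjoint y" "spectrum y \<subseteq> ball 0 1" for y :: 'a
  proof -
    show sa: "selfadjoint (1 - y)" using that(1) by (simp add: selfadjoint_def star_diff)
    show "positive_spectrum (1 - y)"
      unfolding positive_spectrum_def
    proof
      fix z assume z: "z \<in> spectrum (1 - y)"
      then have "z \<in> \<real>" by (rule selfadjoint_spectrum_real[OF sa])
      then obtain r where r: "z = of_real r" by (auto elim: Reals_cases)
      have "(1 - z) *\<^sub>C 1 - y = - (z *\<^sub>C 1 - (1 - y))" by (simp add: scaleC_diff_left)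
      then have "is_invertible ((1 - z) *\<^sub>C 1 - y) \<longleftrightarrow> is_invertible (z *\<^sub>C 1 - (1 - y))"
        by (metis is_invertible_minus)
      then have "1 - z \<in> spectrum y" using z by (simp add: spectrum_def)
      then have "cmod (of_real (1 - r)) < 1" using that(2) r by auto
      then have "r > 0" by (simp only: norm_of_real)
      then show "z \<in> complex_of_real ` {0<..}" using r by auto
    qed
  qed
  have skew: "(x\<^sup>\<star> - x)\<^sup>\<star> = - (x\<^sup>\<star> - x)" by (simp add: star_diff star_star)
  have sa: "selfadjoint (x\<^sup>\<star> * x)" "selfadjoint (x * x\<^sup>\<star>)"
    by (simp_all add: selfadjoint_def star_mult star_star)
  have "(1 + x\<^sup>\<star>) * (1 - x) = (1 - x\<^sup>\<star> * x) + (x\<^sup>\<star> - x)" by (simp add: algebra_simps)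
  then show "is_invertible ((1 + x\<^sup>\<star>) * (1 - x))"
    using is_invertible_positive_plus_skew[OF pos[OF sa(1) spec] skew] by simp
  have "(1 - x) * (1 + x\<^sup>\<star>) = (1 - x * x\<^sup>\<star>) + (x\<^sup>\<star> - x)" by (simp add: algebra_simps)
  then show "is_invertible ((1 - x) * (1 + x\<^sup>\<star>))"
    using is_invertible_positive_plus_skew[OF pos[OF sa(2) spectrum_mult_swap_ball[OF spec]] skew] by simp
qed

text \<open>Ptak's inequality, by homogeneity: the previous lemma applies to \<open>x / z\<close> when \<open>1 \<le> cmod z\<close>.\<close>

lemma spectrum_ptak:
  fixes x :: 'a
  assumes spec: "spectrum (x\<^sup>\<star> * x) \<subseteq> ball 0 1"
  shows "spectrum x \<subseteq> ball 0 1"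
proof
  fix z assume z: "z \<in> spectrum x"
  show "z \<in> ball 0 1"
  proof (rule ccontr)
    assume "z \<notin> ball 0 1"
    then have z1: "cmod z \<ge> 1" by simp
    then have z0: "z \<noteq> 0" by auto
    define x' where "x' = inverse z *\<^sub>C x"
    define c where "c = cnj (inverse z) * inverse z"
    have c: "c \<noteq> 0" "cmod c \<le> 1"
      using z0 z1 by (auto simp: c_def norm_mult norm_inverse intro!: mult_le_one inverse_le_1_iff[THEN iffD2])
    have x'x': "x'\<^sup>\<star> * x' = c *\<^sub>C (x\<^sup>\<star> * x)"
      by (simp add: x'_def c_def star_scaleC mult_scaleC_left mult_scaleC_right scaleC_scaleC
          mult.commute)
    have "spectrum (x'\<^sup>\<star> * x') \<subseteq> ball 0 1"
    proof
      fix w assume w: "w \<in> spectrum (x'\<^sup>\<star> * x')"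
      have "w *\<^sub>C 1 - x'\<^sup>\<star> * x' = c *\<^sub>C ((w / c) *\<^sub>C 1 - x\<^sup>\<star> * x)"
        using c(1) by (simp add: x'x' scaleC_diff_right scaleC_scaleC)
      then have "w / c \<in> spectrum (x\<^sup>\<star> * x)"
        using w c(1) by (simp add: spectrum_def is_invertible_scaleC)
      then have "cmod (w / c) < 1" using spec by auto
      moreover have "cmod w = cmod c * cmod (w / c)" using c(1) by (simp flip: norm_mult)
      ultimately have "cmod w < 1"
        using c(2) mult_right_mono[OF c(2), of "cmod (w / c)"] by simp
      then show "w \<in> ball 0 1" by simp
    qed
    then have "is_invertible (1 - x')" by (rule is_invertible_one_minus_ptak)
    then show False using z is_invertible_diff_iff[OF z0, of x] by (simp add: x'_def)
  qed
qed

text \<open>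
  The spectral radius is submultiplicative on pairs of selfadjoint elements, although these need
  not commute (here for radii below \<open>1\<close>). By Ptak's inequality \<open>r(h k)\<^sup>2 \<le> r(k h\<^sup>2 k) = r(h\<^sup>2 k\<^sup>2)\<close>, and after enough
  squarings the norm of \<open>h\<^sup>N k\<^sup>N\<close> is small.
\<close>

lemma spectrum_mult_selfadjoint:
  fixes h k :: 'a
  assumes h: "selfadjoint h" "powers_dominated h s" "s < 1"
    and k: "selfadjoint k" "powers_dominated k t" "t < 1"
  shows "spectrum (h * k) \<subseteq> ball 0 1"
proof -
  let ?P = "\<lambda>n. spectrum (h ^ (2 ^ n) * k ^ (2 ^ n)) \<subseteq> ball 0 1"
  have step: "?P n" if "?P (Suc n)" for n
  proof (rule spectrum_ptak)
    let ?H = "h ^ (2 ^ n)" and ?K = "k ^ (2 ^ n)"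
    have dbl: "h ^ (2 ^ Suc n) = ?H * ?H" "k ^ (2 ^ Suc n) = ?K * ?K"
      by (simp_all add: mult_2 power_add)
    have "(?H * ?K)\<^sup>\<star> * (?H * ?K) = ?K * (?H * ?H * ?K)"
      using h(1) k(1) by (simp add: star_mult star_power selfadjoint_def mult.assoc)
    moreover have "spectrum ((?H * ?H * ?K) * ?K) \<subseteq> ball 0 1"
      using that unfolding dbl by (simp add: mult.assoc)
    ultimately show "spectrum ((?H * ?K)\<^sup>\<star> * (?H * ?K)) \<subseteq> ball 0 1"
      using spectrum_mult_swap_ball by metis
  qed
  have down: "?P n \<Longrightarrow> ?P 0" for n by (induction n) (use step in blast)+
  obtain M where M: "M > 0" "\<And>n. norm (h ^ n) \<le> M * s ^ n" using h powers_dominatedE by metis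
  obtain N where N: "N > 0" "\<And>n. norm (k ^ n) \<le> N * t ^ n" using k powers_dominatedE by metis
  have st: "s \<ge> 0" "t \<ge> 0" using h k by (auto simp: powers_dominated_def)
  have "(\<lambda>n. M * N * s ^ n) \<longlonglongrightarrow> M * N * 0"
    using st h(3) by (intro tendsto_intros LIMSEQ_power_zero) auto
  then have "eventually (\<lambda>n. M * N * s ^ n < 1) sequentially"
    by (rule order_tendstoD) simp
  then obtain n where n: "M * N * s ^ n < 1" by (auto simp: eventually_sequentially)
  have "norm (h ^ (2 ^ n) * k ^ (2 ^ n)) \<le> (M * s ^ (2 ^ n)) * (N * t ^ (2 ^ n))"
    using M N st by (intro order_trans[OF norm_mult_ineq] mult_mono) auto
  also have "\<dots> \<le> (M * s ^ n) * (N * 1)"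
    using M N st h(3) k(3) less_exp[of n]
    by (intro mult_mono power_decreasing power_le_one) auto
  also have "\<dots> < 1" using n by (simp add: mult_ac)
  finally have "?P n" using spectrum_bounded[of "h ^ (2 ^ n) * k ^ (2 ^ n)"] by force
  then have "?P 0" by (rule down)
  then show ?thesis by simp
qed

text \<open>The Cayley transform maps the positive half-line into the open unit disc.\<close>

lemma cayley_transform:
  fixes x :: 'a
  assumes x: "selfadjoint x" "positive_spectrum x"
  obtains s where "s < 1" "selfadjoint (ring_inverse (1 + x) * (1 - x))"
    "powers_dominated (ring_inverse (1 + x) * (1 - x)) s" "is_invertible (1 + x)"
    "ring_inverse (1 + x) * (1 - x) = (1 - x) * ring_inverse (1 + x)"
proof -
  define h where "h = ring_inverse (1 + x) * (1 - x)"
  have "-1 \<notin> spectrum x"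
    using positive_spectrumD[OF x(2), of "-1"] by (auto simp: complex_eq_iff)
  then have "is_invertible (- (1 + x))" by (simp add: not_in_spectrum_iff scaleC_minus_left)
  then have inv: "is_invertible (1 + x)" by (simp only: is_invertible_minus)
  have comm: "h = (1 - x) * ring_inverse (1 + x)"
    unfolding h_def using inv by (intro ring_inverse_commute) (simp_all add: algebra_simps)
  have sa: "selfadjoint h"
    unfolding selfadjoint_def using x(1) inv
    by (subst h_def) (simp add: star_mult star_ring_inverse star_diff star_add selfadjoint_def comm)
  have "spectrum h \<subseteq> ball 0 1"
  proof
    fix z assume z: "z \<in> spectrum h"
    show "z \<in> ball 0 1"
    proof (rule ccontr)
      assume "z \<notin> ball 0 1"
      then have z1: "cmod z \<ge> 1" by simp
      have "(1 + x) * (z *\<^sub>C 1 - h) = (z - 1) *\<^sub>C 1 + (z + 1) *\<^sub>C x"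
        using inv by (simp add: right_diff_distrib h_def mult_scaleC_right scaleC_algebra_simps)
      moreover have "is_invertible ((z - 1) *\<^sub>C 1 + (z + 1) *\<^sub>C x)"
      proof (cases "z = -1")
        case True
        then show ?thesis by (simp add: is_invertible_scaleC)
      next
        case False
        then have z1': "z + 1 \<noteq> 0" by (simp add: add_eq_0_iff2)
        have "(1 - z) / (z + 1) \<notin> spectrum x"
        proof
          assume "(1 - z) / (z + 1) \<in> spectrum x"
          then obtain r where r: "r > 0" "(1 - z) / (z + 1) = of_real r"
            using positive_spectrumD[OF x(2)] by blast
          then have "1 - z = of_real r * (z + 1)" using z1' by (simp add: field_simps)
          then have "z * of_real (1 + r) = of_real (1 - r)" by (simp add: algebra_simps)
          then have "cmod z * (1 + r) = \<bar>1 - r\<bar>"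
            using r(1) by (metis abs_of_pos add_pos_pos norm_mult norm_of_real zero_less_one)
          moreover have "cmod z * (1 + r) \<ge> 1 * (1 + r)" using z1 r(1) by (intro mult_right_mono) auto
          ultimately show False using r(1) by (simp add: abs_if split: if_splits)
        qed
        then have "is_invertible ((- (z + 1)) *\<^sub>C (((1 - z) / (z + 1)) *\<^sub>C 1 - x))"
          using z1' by (simp add: is_invertible_scaleC not_in_spectrum_iff del: minus_add_distrib)
        moreover have "(z + 1) * ((1 - z) / (z + 1)) = 1 - z" using z1' by simp
        then have "(- (z + 1)) * ((1 - z) / (z + 1)) = z - 1"
          by (simp only: mult_minus_left minus_diff_eq)
        then have "(- (z + 1)) *\<^sub>C (((1 - z) / (z + 1)) *\<^sub>C 1 - x) = (z - 1) *\<^sub>C 1 + (z + 1) *\<^sub>C x"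
          unfolding scaleC_diff_right scaleC_scaleC by (simp only: scaleC_minus_left) simp
        ultimately show ?thesis by simp
      qed
      ultimately have "is_invertible (ring_inverse (1 + x) * ((1 + x) * (z *\<^sub>C 1 - h)))"
        using inv by (simp only: is_invertible_mult is_invertible_ring_inverse)
      then show False using z inv by (simp add: spectrum_def)
    qed
  qed
  then obtain s where "s < 1" "powers_dominated h s"
    using powers_dominated_of_spectrum by (metis zero_less_one)
  then show ?thesis using that inv sa comm by (simp add: h_def)
qed

text \<open>
  The Cayley transforms \<open>h\<close> and \<open>k\<close> of \<open>x\<close> and \<open>y\<close> factor the sum as
  \<open>2 (x + y) = (1 + x) (1 - h k) (1 + y)\<close>.
\<close>

lemma is_invertible_add_positive:
  fixes x y :: 'a
  assumes x: "selfadjoint x" "positive_spectrum x" and y: "selfadjoint y" "positive_spectrum y"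
  shows "is_invertible (x + y)"
proof -
  define h where "h = ring_inverse (1 + x) * (1 - x)"
  define k where "k = ring_inverse (1 + y) * (1 - y)"
  obtain s where h: "s < 1" "selfadjoint h" "powers_dominated h s" "is_invertible (1 + x)"
    using cayley_transform[OF x] unfolding h_def by blast
  obtain t where k: "t < 1" "selfadjoint k" "powers_dominated k t" "is_invertible (1 + y)"
      "k = (1 - y) * ring_inverse (1 + y)"
    using cayley_transform[OF y] unfolding k_def by blast
  have "1 \<notin> spectrum (h * k)"
    using spectrum_mult_selfadjoint[OF h(2,3,1) k(2,3,1)] by auto
  then have "is_invertible (1 - h * k)" by (simp add: not_in_spectrum_iff)
  then have "is_invertible ((1 + x) * (1 - h * k) * (1 + y))"
    by (intro is_invertible_mult h k)
  moreover have "(1 + x) * (1 - h * k) * (1 + y) = 2 *\<^sub>C (x + y)"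
  proof -
    have "(1 + x) * (1 - h * k) * (1 + y) = (1 + x) * (1 + y) - (1 + x) * h * (k * (1 + y))"
      by (simp only: right_diff_distrib left_diff_distrib mult_1_right mult.assoc)
    also have "(1 + x) * h = 1 - x" using h(4) by (simp add: h_def)
    also have "k * (1 + y) = 1 - y" using k(4) by (simp add: k(5) mult.assoc)
    also have "(1 + x) * (1 + y) - (1 - x) * (1 - y) = (1 + 1) *\<^sub>C (x + y)"
      unfolding scaleC_add_left by (simp add: algebra_simps)
    finally show ?thesis by simp
  qed
  ultimately show ?thesis by (simp add: is_invertible_scaleC)
qed

text \<open>
  The spectrum of the selfadjoint element \<open>g b g\<close> is real, and for \<open>r \<ge> 0\<close> the element
  \<open>r + g b g = g (r a + b) g\<close> is invertible, a sum of positive elements being so.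
\<close>

lemma positive_spectrum_conjugate:
  fixes a b :: 'a
  assumes a: "selfadjoint a" "positive_spectrum a" and b: "selfadjoint b" "positive_spectrum b"
  shows "positive_spectrum (rpow a (-1/2) * b * rpow a (-1/2))"
proof -
  define w where "w = rpow a (1/2)"
  define g where "g = rpow a (-1/2)"
  have gw: "w * g = 1" "g * w = 1"
    using rpow_inverse_pairs[OF a(2), of "1/2"] by (simp_all add: w_def g_def)
  have w2: "w * w = a" unfolding w_def by (simp add: rpow_add[OF a(2)] rpow_1[OF a(2)])
  have inv: "is_invertible w" "is_invertible g" using gw by (auto intro: is_invertibleI)
  have "w\<^sup>\<star> = w" using selfadjoint_rpow_half[OF a] by (simp add: w_def selfadjoint_def)
  moreover have "g = ring_inverse w" using gw by (intro ring_inverse_eqI[symmetric])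
  ultimately have gs: "g\<^sup>\<star> = g" by (simp add: star_ring_inverse inv)
  have sa: "selfadjoint (g * b * g)"
    using b(1) by (simp add: selfadjoint_def star_mult gs mult.assoc)
  have inv_sum: "is_invertible (of_real r *\<^sub>C 1 + g * b * g)" if "r \<ge> 0" for r
  proof -
    have "is_invertible (of_real r *\<^sub>C a + b)"
    proof (cases "r = 0")
      case True
      then show ?thesis using positive_spectrum_invertible[OF b(2)] by simp
    next
      case False
      then have r: "r > 0" using that by simp
      show ?thesis
      proof (rule is_invertible_add_positive[OF _ _ b])
        show "selfadjoint (of_real r *\<^sub>C a)" using a(1) by (simp add: selfadjoint_def star_scaleC)
        show "positive_spectrum (of_real r *\<^sub>C a)"
          unfolding positive_spectrum_def
        proof
          fix z assume z: "z \<in> spectrum (of_real r *\<^sub>C a)"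
          have "z *\<^sub>C 1 - of_real r *\<^sub>C a = of_real r *\<^sub>C ((z / of_real r) *\<^sub>C 1 - a)"
            using r by (simp add: scaleC_diff_right scaleC_scaleC)
          then have "z / of_real r \<in> spectrum a" using z r by (simp add: spectrum_def is_invertible_scaleC)
          then obtain t where "t > 0" "z / of_real r = of_real t" using positive_spectrumD[OF a(2)] by blast
          then have "z = of_real (t * r)" "t * r > 0" using r by (auto simp: field_simps)
          then show "z \<in> complex_of_real ` {0<..}" by blast
        qed
      qed
    qed
    then have "is_invertible (g * (of_real r *\<^sub>C a + b) * g)" by (intro is_invertible_mult inv)
    moreover have "g * a * g = (g * w) * (w * g)" by (simp add: mult.assoc flip: w2)
    then have "g * (of_real r *\<^sub>C a + b) * g = of_real r *\<^sub>C 1 + g * b * g"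
      by (simp add: distrib_left distrib_right mult_scaleC_left mult_scaleC_right gw)
    ultimately show ?thesis by simp
  qed
  have "positive_spectrum (g * b * g)"
    unfolding positive_spectrum_def
  proof
    fix z assume z: "z \<in> spectrum (g * b * g)"
    then obtain r where r: "z = of_real r"
      using selfadjoint_spectrum_real[OF sa] by (auto elim: Reals_cases)
    have "r > 0"
    proof (rule ccontr)
      assume "\<not> r > 0"
      then have "is_invertible (of_real (- r) *\<^sub>C 1 + g * b * g)" by (intro inv_sum) simp
      moreover have "z *\<^sub>C 1 - g * b * g = - (of_real (- r) *\<^sub>C 1 + g * b * g)"
        by (simp add: r scaleC_minus_left)
      ultimately have "is_invertible (z *\<^sub>C 1 - g * b * g)" by (simp only: is_invertible_minus)
      then show False using z by (simp add: spectrum_def)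
    qed
    then show "z \<in> complex_of_real ` {0<..}" using r by auto
  qed
  then show ?thesis by (simp add: g_def)
qed

end

lemma strictly_posD:
  assumes "strictly_pos a"
  shows "selfadjoint a" "positive_spectrum a"
proof -
  show "selfadjoint a" using assms unfolding strictly_pos_def nonneg_def by blast
  have sub: "spectrum a \<subseteq> \<real>\<^sub>\<ge>\<^sub>0" and 0: "0 \<notin> spectrum a"
    using assms unfolding strictly_pos_def nonneg_def by blast+
  show "positive_spectrum a"
    unfolding positive_spectrum_def
  proof
    fix z assume z: "z \<in> spectrum a"
    then obtain r where r: "z = of_real r" "r \<ge> 0" using sub nonneg_Reals_cases by blast
    then have "r > 0" using z 0 by (cases "r = 0") auto
    then show "z \<in> complex_of_real ` {0<..}" using r by auto
  qed
qed

section \<open>Symmetry of the weighted geometric mean\<close>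

theorem proposition1:
  fixes a b :: "'a::banach_star_algebra" and \<nu> :: real
  assumes "hermitian_algebra TYPE('a)"
    and "strictly_pos a" and "strictly_pos b"
  shows "b \<sharp>\<^bsub>1 - \<nu>\<^esub> a = a \<sharp>\<^bsub>\<nu>\<^esub> b"
proof -
  note a = strictly_posD[OF assms(2)] and b = strictly_posD[OF assms(3)]
  define p p' q q' where "p = rpow a (1/2)" and "p' = rpow a (-1/2)"
    and "q = rpow b (1/2)" and "q' = rpow b (-1/2)"
  have pp: "p * p' = 1" "p' * p = 1" "p * p = a"
    using rpow_inverse_pairs[OF a(2), of "1/2"]
    by (simp_all add: p_def p'_def rpow_add[OF a(2)] rpow_1[OF a(2)])
  have qq: "q * q' = 1" "q' * q = 1" "q * q = b"
    using rpow_inverse_pairs[OF b(2), of "1/2"]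
    by (simp_all add: q_def q'_def rpow_add[OF b(2)] rpow_1[OF b(2)])
  have cancel: "p * (p' * x) = x" "p' * (p * x) = x" "q * (q' * x) = x" "q' * (q * x) = x" for x
    by (simp_all add: pp qq flip: mult.assoc)
  define c where "c = p' * b * p'"
  have c: "positive_spectrum c"
    unfolding c_def p'_def by (rule positive_spectrum_conjugate[OF assms(1) a b])
  \<comment> \<open>With \<open>x = p' * q\<close> one has \<open>c = x * y\<close>, and \<open>e = y * x\<close> below is similar to \<open>c\<close>.\<close>
  define y y' where "y = q * p'" and "y' = p * q'"
  have yy: "y * y' = 1" "y' * y = 1"
    by (simp_all add: y_def y'_def mult.assoc cancel pp(1,2) qq(1,2))
  define e where "e = y * c * y'"
  have e: "positive_spectrum e"
    using c by (simp add: e_def positive_spectrum_def spectrum_similar[OF yy])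
  have e_eq: "e = q * p' * p' * q"
    by (simp add: e_def c_def y_def y'_def mult.assoc cancel pp(1,2) qq(1,2) flip: qq(3))
  have inv_e: "ring_inverse e = q' * a * q'"
    by (rule ring_inverse_eqI) (simp_all add: e_eq mult.assoc cancel pp(1,2) qq(1,2) flip: pp(3))
  have "rpow (q' * a * q') (1 - \<nu>) = rpow e (\<nu> - 1)"
    using rpow_ring_inverse[OF e, of "1 - \<nu>"] by (simp add: inv_e)
  also have "\<dots> = rpow e (- 1) * rpow e \<nu>" by (simp add: rpow_add[OF e])
  also have "rpow e (- 1) = q' * a * q'"
    using rpow_ring_inverse[OF e, of 1] rpow_1[OF positive_spectrum_ring_inverse[OF e]] by (simp add: inv_e)
  also have "rpow e \<nu> = y * rpow c \<nu> * y'"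
    unfolding e_def by (rule rpow_similar[OF yy c])
  finally have "q * rpow (q' * a * q') (1 - \<nu>) * q = p * rpow c \<nu> * p"
    by (simp add: y_def y'_def mult.assoc cancel pp(1,2) qq(1,2) flip: pp(3))
  then show ?thesis
    by (simp add: geo_mean_def c_def p_def p'_def q_def q'_def)
qed

end
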